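(* Let $p\ge 3$ be a prime, and let $f\colon\mathbb F_p^2\to\mathbb C$ be a nonzero rational-valued function. Write $S:=\operatorname{supp} f\subseteq\mathbb F_p^2$ and $X:=\operatorname{supp}\hat f\subseteq\widehat{\mathbb F_p^2}$. Then $$\frac12\,\min\{|S|,|X|\}+\frac1{p-1}\,\max\{|S|,|X|\}\ge p+1,$$ except if there exists a nonzero, proper subgroup $H<\mathbb F_p^2$ such that $f$ is constant on each $H$-coset (in which case $X=H^\perp$ if the sum of all values of $f$ is nonzero, and $X=H^\perp\setminus\{1\}$ if the sum is equal to $0$).
   Context: $\mathbb F_p^2$ is regarded as an additive group $G$ (the elementary abelian $p$-group of rank $2$); $\widehat G$ is its group of complex characters, with principal character denoted $1$. For $f\colon G\to\mathbb C$, the Fourier transform $\hat f\colon\widehat G\to\mathbb C$ is $\hat f(\chi)=\frac1{|G|}\sum_{g\in G}f(g)\overline{\chi(g)}$. For a subgroup $H\le G$, an $H$-coset is a coset of $H$ in $G$, and $H^\perp:=\{\chi\in\widehat G\colon H\le\ker\chi\}$. The support $\operatorname{supp}$ of a function is the set of points where it is nonzero.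
   Formalization: The description of X in parentheses is claimed only for nonconstant f: for a nonzero constant f every nonzero proper subgroup H qualifies, but X={1} is not H^⊥. The inequality itself holds for constant f. *)

theory Defs
  imports "HOL-Analysis.Analysis" "Berlekamp_Zassenhaus.Finite_Field"
begin

text \<open>Characters are kept as plain functions. Multiplicativity together with the value \<open>1\<close> at \<open>0\<close>
  excludes the zero function, so these are exactly the homomorphisms into the nonzero complex
  numbers.\<close>

definition characters :: "('g::ab_group_add \<Rightarrow> complex) set" where
  "characters = {\<psi>. \<psi> 0 = 1 \<and> (\<forall>x y. \<psi> (x + y) = \<psi> x * \<psi> y)}"

definition principal_character :: "'g::ab_group_add \<Rightarrow> complex" where
  "principal_character = (\<lambda>_. 1)"

definition fourier ::
  "('g::{finite,ab_group_add} \<Rightarrow> complex) \<Rightarrow> ('g \<Rightarrow> complex) \<Rightarrow> complex" where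
  "fourier f \<psi> = 1 / of_nat CARD('g) * (\<Sum>g\<in>UNIV. f g * cnj (\<psi> g))"

definition supp :: "('g::{finite,ab_group_add} \<Rightarrow> complex) \<Rightarrow> 'g set" where
  "supp f = support_on UNIV f"

text \<open>The transform is a function on the dual group only, hence the restriction to
  \<^const>\<open>characters\<close>.\<close>

definition fourier_supp ::
  "('g::{finite,ab_group_add} \<Rightarrow> complex) \<Rightarrow> ('g \<Rightarrow> complex) set" where
  "fourier_supp f = support_on characters (fourier f)"

definition add_subgroup :: "'g::ab_group_add set \<Rightarrow> bool" where
  "add_subgroup H \<longleftrightarrow> 0 \<in> H \<and> (\<forall>x\<in>H. \<forall>y\<in>H. x + y \<in> H) \<and> (\<forall>x\<in>H. - x \<in> H)"

definition char_kernel :: "('g::ab_group_add \<Rightarrow> complex) \<Rightarrow> 'g set" where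
  "char_kernel \<psi> = {g. \<psi> g = 1}"

definition perp :: "'g::ab_group_add set \<Rightarrow> ('g \<Rightarrow> complex) set" where
  "perp H = {\<psi> \<in> characters. H \<subseteq> char_kernel \<psi>}"

text \<open>The coset \<open>g + H\<close> is written \<open>g +o H\<close>.\<close>

definition exceptional_subgroup ::
  "('g::ab_group_add \<Rightarrow> complex) \<Rightarrow> 'g set \<Rightarrow> bool" where
  "exceptional_subgroup f H \<longleftrightarrow>
     add_subgroup H \<and> H \<noteq> {0} \<and> H \<noteq> UNIV \<and> (\<forall>g. f constant_on (g +o H))"

text \<open>For a nonzero constant \<open>f\<close> every proper nontrivial subgroup is exceptional, yet the transform is
  supported on the principal character alone, so the following description of its support fails.\<close>

definition fourier_supp_from_subgroup ::
  "('g::{finite,ab_group_add} \<Rightarrow> complex) \<Rightarrow> 'g set \<Rightarrow> bool" where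
  "fourier_supp_from_subgroup f H \<longleftrightarrow>
     ((\<Sum>g\<in>UNIV. f g) \<noteq> 0 \<longrightarrow> fourier_supp f = perp H) \<and>
     ((\<Sum>g\<in>UNIV. f g) = 0 \<longrightarrow> fourier_supp f = perp H - {principal_character})"

end

theory Submission
  imports Defs "HOL-Computational_Algebra.Polynomial_Factorial"
begin

text \<open>
  Lines of the plane over the field with \<open>p\<close> elements fall into \<open>p + 1\<close> directions. Call a direction null
  if the sums of \<open>f\<close> over its lines all agree. A nontrivial character is constant on the lines of one
  direction, and its Fourier coefficient is the combination of the \<open>p\<close>-th roots of unity weighted by the
  sums over these lines. Since \<open>1 + x + \<dots> + x^(p - 1)\<close> is irreducible, rationality of \<open>f\<close> makes the
  coefficient vanish only if the direction is null (\<open>null_direction_of_fourier_zero\<close>). So \<open>m\<close>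
  non-null directions give \<open>|X| \<ge> m (p - 1)\<close> (\<open>card_fourier_supp_ge\<close>). If \<open>m \<le> 1\<close>, then \<open>f\<close> is
  determined by its sums over the lines of a single direction (\<open>constant_on_fibres\<close>), which gives
  the exceptional subgroup, or \<open>f\<close> is constant and the inequality is immediate. If \<open>m \<ge> 2\<close>, the
  inequality follows from the bound \<open>|S| \<ge> 2 (p + 1 - m)\<close> (\<open>card_supp_ge\<close>).

  For that bound let \<open>f\<close> be integer-valued, with \<open>n = p + 1 - m\<close> null directions and \<open>|S| < 2 n\<close>, and not
  divisible by \<open>p\<close>. Modulo \<open>p\<close>, the function \<open>f\<close> is orthogonal to the \<open>k\<close>-th powers of the \<open>n\<close> linear
  forms belonging to null directions for \<open>k < n\<close>, and hence to all polynomials of degree less than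
  \<open>n\<close> (\<open>kills_degree_of_fibre_sums\<close>). A support of at most \<open>2 (n - 1) + 1\<close> points with this
  property lies on a line (\<open>kills_degree_collinear\<close>), and then \<open>f\<close> is modulo \<open>p\<close> a nonzero constant
  \<open>c\<close> on that line, \<open>c\<close> being the sum of \<open>f\<close> over any line in a null direction (\<open>few_points_mod_p\<close>).
  In particular a function of such small support cannot have the common sum \<open>0\<close> unless it vanishes
  (\<open>few_points_sum_zero\<close>). Applied to \<open>f\<close> minus \<open>c\<close> times the indicator of the line, this shows
  that \<open>f\<close> is a multiple of that indicator (\<open>few_points_line\<close>); but then \<open>m = 1\<close>.
\<close>

(* Univariate polynomials are meant throughout, not their record-based namesakes. *)
hide_const (open) up_ring.coeff up_ring.monom module.smult

section \<open>Rational relations among the roots of unity of prime order\<close>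

text \<open>The polynomial \<open>1 + x + \<dots> + x^(n - 1)\<close>. For prime \<open>n\<close> it is the cyclotomic polynomial of order
  \<open>n\<close>. The coefficient ring is left open because the reduction modulo the prime is needed too.\<close>
definition all_ones_poly :: "nat \<Rightarrow> 'a::comm_ring_1 poly" where
  "all_ones_poly n = (\<Sum>k<n. [:0, 1:] ^ k)"

lemma coeff_all_ones_poly:
  "coeff (all_ones_poly n :: 'a::comm_ring_1 poly) k = (if k < n then 1 else 0)"
proof -
  have "coeff ([:0, 1:] ^ j :: 'a poly) k = (if j = k then 1 else 0)" for j
    by (metis coeff_monom monom_altdef smult_1_left)
  then show ?thesis
    by (simp add: all_ones_poly_def coeff_sum)
qed

lemma degree_all_ones_poly:
  assumes "n > 0"
  shows "degree (all_ones_poly n :: 'a::comm_ring_1 poly) = n - 1"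
proof (rule antisym)
  show "degree (all_ones_poly n :: 'a poly) \<le> n - 1"
    by (rule degree_le) (auto simp: coeff_all_ones_poly)
  show "n - 1 \<le> degree (all_ones_poly n :: 'a poly)"
    by (rule le_degree) (use assms in \<open>auto simp: coeff_all_ones_poly\<close>)
qed

lemma all_ones_poly_mod_p:
  "(all_ones_poly CARD('p) :: 'p::prime_card mod_ring poly) = [:-1, 1:] ^ (CARD('p) - 1)"
proof -
  let ?x = "[:0, 1:] :: 'p mod_ring poly" and ?y = "[:-1, 1:] :: 'p mod_ring poly"
  have p: "prime CARD('p)" by (rule prime_card)
  have y: "?y = ?x - 1" by (simp add: one_pCons)
  have "?x ^ CARD('p) = (?y + 1) ^ CARD('p)" by (simp add: y)
  also have "\<dots> = ?y ^ CARD('p) + 1 ^ CARD('p)"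
    by (rule freshmans_dream) (simp_all add: p)
  finally have "?y ^ CARD('p) = ?x ^ CARD('p) - 1" by simp
  also have "\<dots> = ?y * all_ones_poly CARD('p)"
    unfolding y all_ones_poly_def by (rule power_diff_1_eq)
  finally have "?y * ?y ^ (CARD('p) - 1) = ?y * all_ones_poly CARD('p)"
    using power_minus_mult[of "CARD('p)" ?y] by (simp add: mult.commute)
  moreover have "?y \<noteq> 0" by simp
  ultimately show ?thesis by (metis mult_left_cancel)
qed

lemma dvd_linear_power_root:
  fixes A :: "'a::field_gcd poly"
  assumes "A dvd [:-c, 1:] ^ n" and "degree A > 0"
  shows "poly A c = 0"
proof (rule ccontr)
  assume "poly A c \<noteq> 0"
  then have "\<not> [:-c, 1:] dvd A" by (simp add: poly_eq_0_iff_dvd)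
  moreover have "prime_elem [:-c, 1:]"
    by (rule prime_elem_linear_field_poly) simp
  ultimately have "coprime [:-c, 1:] A" by (rule prime_elem_imp_coprime[rotated])
  then have "coprime ([:-c, 1:] ^ n) A" by simp
  with assms(1) have "A dvd 1"
    by (metis coprime_common_divisor dvd_refl)
  with assms(2) show False by (auto simp: is_unit_iff_degree)
qed

text \<open>Eisenstein's argument without the shift \<open>x \<mapsto> x + 1\<close>: modulo \<open>p\<close> the polynomial is a power of
  \<open>x - 1\<close>, so each of two nonconstant factors would have a value divisible by \<open>p\<close> at \<open>1\<close>, whereas
  the product has the value \<open>p\<close> there.\<close>
lemma irreducible_all_ones_poly:
  "irreducible (all_ones_poly CARD('p::prime_card) :: int poly)"
proof (rule irreducibleI)
  let ?\<Phi> = "all_ones_poly CARD('p) :: int poly"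
  let ?h = "map_poly of_int :: int poly \<Rightarrow> 'p mod_ring poly"
  have p: "prime CARD('p)" by (rule prime_card)
  then have p2: "CARD('p) \<ge> 2" by (rule prime_ge_2_nat)
  have deg: "degree ?\<Phi> = CARD('p) - 1" using p2 by (intro degree_all_ones_poly) simp
  show "?\<Phi> \<noteq> 0" using deg p2 by auto
  show "\<not> ?\<Phi> dvd 1" using deg p2 by (auto simp: is_unit_poly_iff)
  fix A B assume AB: "?\<Phi> = A * B"
  have lead: "lead_coeff A * lead_coeff B = 1"
    using arg_cong[OF AB, of lead_coeff] p2
    by (simp add: lead_coeff_mult deg coeff_all_ones_poly)
  have h\<Phi>: "?h ?\<Phi> = all_ones_poly CARD('p)"
    by (rule poly_eqI) (simp add: coeff_map_poly coeff_all_ones_poly)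
  have root: "int CARD('p) dvd poly C 1"
    if "C dvd ?\<Phi>" "lead_coeff C dvd 1" "degree C > 0" for C
  proof -
    have "of_int (lead_coeff C) \<noteq> (0 :: 'p mod_ring)"
      using that(2) by (auto simp: zdvd1_eq abs_if split: if_splits)
    then have "degree (?h C) > 0"
      using that(3) by (metis coeff_map_poly le_degree of_int_0 order_less_le_trans)
    moreover have "?h C dvd [:-1, 1:] ^ (CARD('p) - 1)"
      using that(1) unfolding all_ones_poly_mod_p[symmetric] h\<Phi>[symmetric]
      by (auto simp: of_int_poly_hom.hom_mult)
    ultimately have "poly (?h C) 1 = 0" by (rule dvd_linear_power_root[rotated])
    then have "of_int (poly C 1) = (0 :: 'p mod_ring)"
      by (metis of_int_1 of_int_hom.poly_map_poly)
    then show ?thesis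
      by (simp add: of_int_eq_0_iff_char_dvd)
  qed
  show "A dvd 1 \<or> B dvd 1"
  proof (rule ccontr)
    assume neg: "\<not> ?thesis"
    have unit: "C dvd 1" if "degree C = 0" "lead_coeff C dvd 1" for C :: "int poly"
      using that by (metis degree_0_id is_unit_const_poly_iff)
    have "lead_coeff A dvd 1" "lead_coeff B dvd 1"
      using lead by (metis dvd_triv_left, metis dvd_triv_right)
    moreover have "A dvd ?\<Phi>" "B dvd ?\<Phi>" using AB by simp_all
    ultimately have "int CARD('p) dvd poly A 1" "int CARD('p) dvd poly B 1"
      using neg unit[of A] unit[of B] root[of A] root[of B] by blast+
    then have "int CARD('p) * int CARD('p) dvd poly ?\<Phi> 1"
      unfolding AB poly_mult by (rule mult_dvd_mono)
    also have "poly ?\<Phi> 1 = int CARD('p)"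
      by (simp add: all_ones_poly_def poly_sum)
    finally have "CARD('p) * CARD('p) dvd CARD('p) * 1"
      by (metis mult.right_neutral of_nat_dvd_iff of_nat_mult)
    then show False using p2 by simp
  qed
qed

text \<open>The only relations with integer coefficients among the powers of a primitive \<open>p\<close>-th
  root of unity \<open>w\<close> are the
  multiples of \<open>1 + w + \<dots> + w^(p - 1) = 0\<close>.\<close>
lemma coeffs_eq_of_root_all_ones_poly:
  fixes w :: complex and a :: "nat \<Rightarrow> int"
  assumes root: "(\<Sum>k<CARD('p::prime_card). w ^ k) = 0"
    and rel: "(\<Sum>k<CARD('p). of_int (a k) * w ^ k) = 0"
    and "j < CARD('p)" "k < CARD('p)"
  shows "a j = a k"
proof -
  let ?p = "CARD('p)"
  let ?\<Phi> = "all_ones_poly ?p :: int poly"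
  let ?ev = "\<lambda>A :: int poly. poly (map_poly of_int A) w"
  have ev_mult: "?ev (A * B) = ?ev A * ?ev B" and ev_add: "?ev (A + B) = ?ev A + ?ev B" for A B
    by (simp_all add: of_int_poly_hom.hom_mult of_int_poly_hom.hom_add)
  have p2: "?p \<ge> 2" by (rule prime_ge_2_nat[OF prime_card])
  have deg: "degree ?\<Phi> = ?p - 1" using p2 by (intro degree_all_ones_poly) simp
  have "map_poly of_int ?\<Phi> = (all_ones_poly ?p :: complex poly)"
    by (rule poly_eqI) (simp add: coeff_map_poly coeff_all_ones_poly)
  then have ev\<Phi>: "?ev ?\<Phi> = 0"
    using root by (simp add: all_ones_poly_def poly_sum)
  have prime: "prime_elem ?\<Phi>"
    by (intro irreducible_imp_prime_elem irreducible_all_ones_poly)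
  have small: "A = 0" if "?ev A = 0" "degree A < ?p - 1" for A
    using that
  proof (induction "degree A" arbitrary: A rule: less_induct)
    case less
    show "A = 0"
    proof (rule ccontr)
      assume "A \<noteq> 0"
      \<comment> \<open>By minimality of the degree of \<open>A\<close>, the remainder of the cyclotomic polynomial vanishes.\<close>
      define R where "R = pseudo_mod ?\<Phi> A"
      obtain l Q where lQ: "l \<noteq> 0" "smult l ?\<Phi> = A * Q + R"
        using pseudo_mod(1)[OF \<open>A \<noteq> 0\<close>] R_def by metis
      have R: "R = 0 \<or> degree R < degree A"
        using pseudo_mod(2)[OF \<open>A \<noteq> 0\<close>] R_def by metis
      have "?ev (smult l ?\<Phi>) = 0"
        using ev\<Phi> ev_mult[of "[:l:]" ?\<Phi>] by simp
      then have "?ev R = 0" using lQ(2) ev_add ev_mult less.prems(1) by simp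
      then have "R = 0" using R less.hyps[of R] less.prems(2) by force
      with lQ have eq: "smult l ?\<Phi> = A * Q" by simp
      then have "?\<Phi> dvd A * Q" by (metis dvd_smult dvd_refl)
      then have "?\<Phi> dvd A \<or> ?\<Phi> dvd Q" using prime by (simp add: prime_elem_dvd_mult_iff)
      moreover have "\<not> ?\<Phi> dvd A"
        using less.prems(2) \<open>A \<noteq> 0\<close> deg by (metis dvd_imp_degree_le leD)
      ultimately have "?\<Phi> dvd Q" by simp
      moreover have "Q \<noteq> 0" using eq lQ(1) deg p2 by auto
      ultimately have "degree ?\<Phi> \<le> degree Q" by (rule dvd_imp_degree_le)
      moreover have "degree ?\<Phi> = degree A + degree Q"
        using arg_cong[OF eq, of degree] lQ(1) \<open>A \<noteq> 0\<close> \<open>Q \<noteq> 0\<close> by (simp add: degree_mult_eq)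
      ultimately have "degree A = 0" by simp
      then obtain c where "A = [:c:]" by (rule degree_eq_zeroE)
      with less.prems(1) \<open>A \<noteq> 0\<close> show False by simp
    qed
  qed
  define A where "A = (\<Sum>k<?p. monom (a k) k) - smult (a (?p - 1)) ?\<Phi>"
  have coeffA: "coeff A i = (if i < ?p then a i - a (?p - 1) else 0)" for i
    by (simp add: A_def coeff_sum coeff_all_ones_poly)
  have "A = 0"
  proof (rule small)
    have "?ev (\<Sum>k<?p. monom (a k) k) = (\<Sum>k<?p. of_int (a k) * w ^ k)"
      by (simp add: of_int_poly_hom.hom_sum poly_sum poly_monom)
    moreover have "A + smult (a (?p - 1)) ?\<Phi> = (\<Sum>k<?p. monom (a k) k)" by (simp add: A_def)
    moreover have "?ev (smult (a (?p - 1)) ?\<Phi>) = 0"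
      using ev\<Phi> ev_mult[of "[:a (?p - 1):]" ?\<Phi>] by simp
    ultimately show "?ev A = 0"
      using rel ev_add[of A "smult (a (?p - 1)) ?\<Phi>"] by simp
    have "degree A \<le> ?p - 2"
    proof (rule degree_le, intro allI impI)
      fix i assume "?p - 2 < i"
      then have "i = ?p - 1 \<or> \<not> i < ?p" by auto
      then show "coeff A i = 0" by (auto simp: coeffA)
    qed
    then show "degree A < ?p - 1" using p2 by linarith
  qed
  then have "a i = a (?p - 1)" if "i < ?p" for i
    using coeffA[of i] that by simp
  then show ?thesis using assms(3,4) by metis
qed

section \<open>Lines and directions in the affine plane\<close>

text \<open>The linear form on the plane with coefficient vector \<open>d\<close>; for \<open>d \<noteq> 0\<close> its fibres are the
  lines of one parallel class.\<close>
definition form :: "'a::comm_ring_1 \<times> 'a \<Rightarrow> 'a \<times> 'a \<Rightarrow> 'a" where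
  "form d g = fst d * fst g + snd d * snd g"

lemma form_add: "form d (g + h) = form d g + form d h"
  and form_diff: "form d (g - h) = form d g - form d h"
  and form_zero [simp]: "form d 0 = 0"
  by (simp_all add: form_def algebra_simps)

lemma line_through_two_points:
  fixes P Q :: "'a::comm_ring_1 \<times> 'a"
  assumes "P \<noteq> Q"
  shows "\<exists>e. e \<noteq> 0 \<and> form e P = form e Q"
proof (intro exI conjI)
  let ?e = "(snd Q - snd P, fst P - fst Q)"
  show "?e \<noteq> 0" using assms by (auto simp: prod_eq_iff)
  show "form ?e P = form ?e Q" by (simp add: form_def algebra_simps)
qed

text \<open>One coefficient vector for each of the parallel classes of lines, that is, the points of the
  projective line in normalised form.\<close>
definition directions :: "('a::field \<times> 'a) set" where
  "directions = insert (0, 1) (range (Pair 1))"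

lemma card_directions: "card (directions :: ('a::{finite,field} \<times> 'a) set) = CARD('a) + 1"
proof -
  have "card (range (Pair (1::'a)) :: ('a \<times> 'a) set) = CARD('a)"
    by (intro card_image injI) simp
  then show ?thesis
    unfolding directions_def by (subst card_insert_disjoint) auto
qed

text \<open>The determinant of two coefficient vectors; it vanishes exactly when one is a multiple of the
  other.\<close>
definition det2 :: "'a::comm_ring_1 \<times> 'a \<Rightarrow> 'a \<times> 'a \<Rightarrow> 'a" where
  "det2 d e = fst d * snd e - snd d * fst e"

lemma directions_nonzero: "d \<in> directions \<Longrightarrow> d \<noteq> 0"
  by (auto simp: directions_def prod_eq_iff)

lemma form_det_zero:
  fixes d e v :: "'a::field \<times> 'a"
  assumes "form d v = 0" "form e v = 0" "v \<noteq> 0"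
  shows "det2 d e = 0"
proof -
  have "det2 d e * fst v = snd e * form d v - snd d * form e v"
    "det2 d e * snd v = fst d * form e v - fst e * form d v"
    by (simp_all add: det2_def form_def algebra_simps)
  with assms show ?thesis by (auto simp: prod_eq_iff)
qed

lemma directions_eqI:
  "d \<in> directions \<Longrightarrow> d' \<in> directions \<Longrightarrow> det2 d d' = 0 \<Longrightarrow> d = d'"
  by (auto simp: directions_def det2_def)

lemma directions_parallel_unique:
  fixes e :: "'a::field \<times> 'a"
  assumes "e \<noteq> 0" "d \<in> directions" "d' \<in> directions" "det2 d e = 0" "det2 d' e = 0"
  shows "d = d'"
proof -
  have "form d (snd e, - fst e) = 0" "form d' (snd e, - fst e) = 0"
    using assms(4,5) by (simp_all add: form_def det2_def)
  moreover have "(snd e, - fst e) \<noteq> 0" using assms(1) by (auto simp: prod_eq_iff)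
  ultimately have "det2 d d' = 0" by (rule form_det_zero)
  with assms(2,3) show ?thesis by (rule directions_eqI)
qed

lemma ex1_direction_through:
  fixes v :: "'a::field \<times> 'a"
  assumes "v \<noteq> 0"
  shows "\<exists>!d. d \<in> directions \<and> form d v = 0"
proof (rule ex_ex1I)
  show "\<exists>d. d \<in> directions \<and> form d v = 0"
  proof (cases "snd v = 0")
    case True
    then show ?thesis by (intro exI[of _ "(0, 1)"]) (simp add: directions_def form_def)
  next
    case False
    then show ?thesis
      by (intro exI[of _ "(1, - fst v / snd v)"]) (simp add: directions_def form_def)
  qed
  show "d = d'" if "d \<in> directions \<and> form d v = 0" "d' \<in> directions \<and> form d' v = 0" for d d'
    using that form_det_zero[OF _ _ assms] directions_eqI by blast
qed

lemma lines_meet_in_point: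
  fixes d e :: "'a::field \<times> 'a"
  assumes "det2 d e \<noteq> 0"
  obtains g where "{h. form d h = t \<and> form e h = s} = {g}"
proof -
  let ?D = "det2 d e"
  let ?g = "((t * snd e - s * snd d) / ?D, (fst d * s - fst e * t) / ?D)"
  have "form d ?g = t * ?D / ?D"
    unfolding form_def fst_conv snd_conv times_divide_eq_right add_divide_distrib[symmetric]
    by (simp add: det2_def algebra_simps)
  moreover have "form e ?g = s * ?D / ?D"
    unfolding form_def fst_conv snd_conv times_divide_eq_right add_divide_distrib[symmetric]
    by (simp add: det2_def algebra_simps)
  ultimately have "form d ?g = t" "form e ?g = s" using assms by simp_all
  then obtain g where g: "form d g = t" "form e g = s" by metis
  have "h = g" if "form d h = t" "form e h = s" for h
  proof (rule ccontr)
    assume "h \<noteq> g"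
    then have "h - g \<noteq> 0" by simp
    moreover have "form d (h - g) = 0" "form e (h - g) = 0"
      using that g by (simp_all add: form_diff)
    ultimately show False using form_det_zero assms by blast
  qed
  with g have "{h. form d h = t \<and> form e h = s} = {g}" by blast
  then show ?thesis by (rule that)
qed

text \<open>The sum of \<open>f\<close> over the line on which the form with coefficient vector \<open>d\<close> takes the value \<open>t\<close>.\<close>
definition fibre_sum :: "('a::{finite,comm_ring_1} \<times> 'a \<Rightarrow> 'b::comm_monoid_add) \<Rightarrow> 'a \<times> 'a \<Rightarrow> 'a \<Rightarrow> 'b" where
  "fibre_sum f d t = (\<Sum>g | form d g = t. f g)"

lemma sum_fibre_sum:
  fixes f :: "'a::{finite,comm_ring_1} \<times> 'a \<Rightarrow> 'b::comm_semiring_0"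
  shows "(\<Sum>g\<in>UNIV. f g * \<phi> (form d g)) = (\<Sum>t\<in>UNIV. fibre_sum f d t * \<phi> t)"
proof -
  have "(\<Sum>g\<in>UNIV. f g * \<phi> (form d g)) = (\<Sum>t\<in>UNIV. \<Sum>g | form d g = t. f g * \<phi> (form d g))"
    using sum.group[of UNIV UNIV "form d" "\<lambda>g. f g * \<phi> (form d g)"] by simp
  also have "\<dots> = (\<Sum>t\<in>UNIV. fibre_sum f d t * \<phi> t)"
    unfolding fibre_sum_def sum_distrib_right by (intro sum.cong) auto
  finally show ?thesis .
qed

lemma fibre_sum_line:
  fixes d e :: "'a::{finite,field} \<times> 'a" and c :: "'b::comm_monoid_add"
  assumes "det2 d e \<noteq> 0"
  shows "fibre_sum (\<lambda>g. if form e g = s then c else 0) d t = c"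
proof -
  obtain g where g: "{h. form d h = t \<and> form e h = s} = {g}"
    using lines_meet_in_point[OF assms] .
  have "fibre_sum (\<lambda>g. if form e g = s then c else 0) d t = (\<Sum>h | form d h = t \<and> form e h = s. c)"
    unfolding fibre_sum_def by (rule sum.mono_neutral_cong_right) auto
  also have "\<dots> = c" by (simp add: g)
  finally show ?thesis .
qed

lemma parallel_forms:
  fixes d e :: "'a::field \<times> 'a"
  assumes "d \<noteq> 0" "e \<noteq> 0" "det2 d e = 0"
  obtains u where "u \<noteq> 0" "\<And>g. form d g = u * form e g"
proof (cases "fst e = 0")
  case True
  then have e: "snd e \<noteq> 0" using assms(2) by (auto simp: prod_eq_iff)
  with True assms(3) have d: "fst d = 0" by (simp add: det2_def)
  with assms(1) have "snd d \<noteq> 0" by (auto simp: prod_eq_iff)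
  with e d True show ?thesis by (intro that[of "snd d / snd e"]) (simp_all add: form_def)
next
  case False
  have d: "snd d = fst d * snd e / fst e" using assms(3) False by (simp add: det2_def field_simps)
  then have "fst d \<noteq> 0" using assms(1) by (auto simp: prod_eq_iff)
  with d False show ?thesis
    by (intro that[of "fst d / fst e"]) (simp_all add: form_def field_simps)
qed

lemma card_fibre:
  fixes d :: "'a::{finite,field} \<times> 'a"
  assumes "d \<noteq> 0"
  shows "card {g. form d g = t} = CARD('a)"
proof (cases "snd d = 0")
  case True
  then have "fst d \<noteq> 0" using assms by (auto simp: prod_eq_iff)
  with True have "{g. form d g = t} = {t / fst d} \<times> UNIV" by (auto simp: form_def field_simps)
  then show ?thesis by (simp add: card_cartesian_product)
next
  case False
  then have "{g. form d g = t} = (\<lambda>x. (x, (t - fst d * x) / snd d)) ` UNIV"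
    by (auto simp: form_def field_simps image_iff)
  then show ?thesis by (simp add: card_image inj_on_def)
qed

section \<open>Functions orthogonal to all polynomials of small degree\<close>

text \<open>\<open>F\<close> is orthogonal to all bivariate polynomials of total degree at most \<open>d\<close>; it suffices to ask this
  of the monomials.\<close>
definition kills_degree :: "nat \<Rightarrow> ('a::{finite,comm_ring_1} \<times> 'a \<Rightarrow> 'a) \<Rightarrow> bool" where
  "kills_degree d F \<longleftrightarrow>
     (\<forall>i j. i + j \<le> d \<longrightarrow> (\<Sum>g\<in>UNIV. F g * fst g ^ i * snd g ^ j) = 0)"

lemma kills_degree_sum: "kills_degree d F \<Longrightarrow> sum F UNIV = 0"
  unfolding kills_degree_def by (drule spec[of _ 0], drule spec[of _ 0]) simp

text \<open>Multiplying by a linear polynomial lowers the degree by one and removes the points of a line from the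
  support. Both bounds on supports below rest on this.\<close>
lemma kills_degree_times_line:
  assumes "kills_degree (Suc d) F"
  shows "kills_degree d (\<lambda>g. F g * (form e g - c))"
  unfolding kills_degree_def
proof (intro allI impI)
  fix i j assume ij: "i + j \<le> d"
  have M: "(\<Sum>g\<in>UNIV. F g * fst g ^ i' * snd g ^ j') = 0" if "i' + j' \<le> Suc d" for i' j'
    using assms that by (simp add: kills_degree_def)
  have "(\<Sum>g\<in>UNIV. F g * (form e g - c) * fst g ^ i * snd g ^ j)
      = fst e * (\<Sum>g\<in>UNIV. F g * fst g ^ Suc i * snd g ^ j)
        + snd e * (\<Sum>g\<in>UNIV. F g * fst g ^ i * snd g ^ Suc j)
        - c * (\<Sum>g\<in>UNIV. F g * fst g ^ i * snd g ^ j)"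
    unfolding sum_distrib_left sum.distrib[symmetric] sum_subtractf[symmetric]
    by (rule sum.cong) (simp_all add: form_def algebra_simps)
  also have "\<dots> = 0"
    using M[of "Suc i" j] M[of i "Suc j"] M[of i j] ij by simp
  finally show "(\<Sum>g\<in>UNIV. F g * (form e g - c) * fst g ^ i * snd g ^ j) = 0" .
qed

lemma kills_degree_one_point:
  assumes "kills_degree d F" "{h. F h \<noteq> 0} \<subseteq> {g}"
  shows "F g = 0"
proof -
  have "sum F UNIV = sum F {g}"
    by (rule sum.mono_neutral_right) (use assms(2) in auto)
  then show ?thesis using kills_degree_sum[OF assms(1)] by simp
qed

lemma kills_degree_few_points:
  fixes F :: "'a::{finite,field} \<times> 'a \<Rightarrow> 'a"
  assumes "kills_degree d F" and "card {g. F g \<noteq> 0} \<le> Suc d"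
  shows "F g = 0"
  using assms
proof (induction d arbitrary: F g)
  case 0
  have "x = y" if "F x \<noteq> 0" "F y \<noteq> 0" for x y
    using 0(2) card_le_Suc0_iff_eq[OF finite, of "{h. F h \<noteq> 0}", THEN iffD1] that by blast
  then have "F g \<noteq> 0 \<Longrightarrow> {h. F h \<noteq> 0} \<subseteq> {g}" by blast
  then show ?case using kills_degree_one_point[OF 0(1)] by blast
next
  case (Suc d)
  show ?case
  proof (rule ccontr)
    assume g: "F g \<noteq> 0"
    then have "\<not> {h. F h \<noteq> 0} \<subseteq> {g}"
      using kills_degree_one_point[OF Suc.prems(1)] by blast
    then obtain h where h: "F h \<noteq> 0" "h \<noteq> g" by blast
    obtain e where e: "form e h \<noteq> form e g"
    proof (cases "fst h = fst g")
      case True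
      then have "form (0, 1) h \<noteq> form (0, 1) g" using h(2) by (auto simp: form_def prod_eq_iff)
      then show ?thesis by (rule that)
    next
      case False
      then have "form (1, 0) h \<noteq> form (1, 0) g" by (simp add: form_def)
      then show ?thesis by (rule that)
    qed
    let ?F = "\<lambda>x. F x * (form e x - form e h)"
    have "{x. ?F x \<noteq> 0} \<subseteq> {x. F x \<noteq> 0} - {h}" by auto
    then have "card {x. ?F x \<noteq> 0} \<le> card ({x. F x \<noteq> 0} - {h})" by (intro card_mono) simp_all
    also have "\<dots> \<le> Suc d" using Suc.prems(2) h(1) by simp
    finally have "?F g = 0"
      by (intro Suc.IH[OF kills_degree_times_line[OF Suc.prems(1)]])
    with g e show False by simp
  qed
qed

text \<open>At most \<open>2 d + 1\<close> points carrying a relation of degree \<open>d\<close> lie on one line. After deleting the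
  line through two support points, which leaves a relation of degree \<open>d - 1\<close>, induction puts the
  remaining points on a line \<open>m\<close>. Unless nothing remains, there are at least \<open>d + 1\<close> of them, so that
  at most \<open>d\<close> points lie outside \<open>m\<close>; these are too few for the relation of degree \<open>d - 1\<close> left by
  deleting \<open>m\<close>.\<close>
lemma kills_degree_collinear:
  fixes F :: "'a::{finite,field} \<times> 'a \<Rightarrow> 'a"
  assumes "kills_degree d F" and "card {g. F g \<noteq> 0} \<le> 2 * d + 1"
  shows "\<exists>e s. e \<noteq> 0 \<and> (\<forall>g. F g \<noteq> 0 \<longrightarrow> form e g = s)"
  using assms
proof (induction d arbitrary: F)
  case 0
  then have "F g = 0" for g by (intro kills_degree_few_points[OF 0(1)]) simp
  then show ?case by (intro exI[of _ "(1, 0)"]) (simp add: prod_eq_iff)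
next
  case (Suc d)
  show ?case
  proof (cases "\<exists>P Q. F P \<noteq> 0 \<and> F Q \<noteq> 0 \<and> P \<noteq> Q")
    case False
    then have "F P \<noteq> 0 \<Longrightarrow> {g. F g \<noteq> 0} \<subseteq> {P}" for P by blast
    then have "F P = 0" for P using kills_degree_one_point[OF Suc.prems(1), of P] by blast
    then show ?thesis by (intro exI[of _ "(1, 0)"]) (simp add: prod_eq_iff)
  next
    case True
    then obtain P Q where PQ: "F P \<noteq> 0" "F Q \<noteq> 0" "P \<noteq> Q" by blast
    then obtain e where e: "e \<noteq> 0" "form e P = form e Q" using line_through_two_points by blast
    define F' where "F' = (\<lambda>g. F g * (form e g - form e P))"
    have kills': "kills_degree d F'"
      unfolding F'_def by (rule kills_degree_times_line[OF Suc.prems(1)])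
    have "{g. F' g \<noteq> 0} \<subseteq> {g. F g \<noteq> 0} - {P, Q}" using e by (auto simp: F'_def)
    then have "card {g. F' g \<noteq> 0} \<le> card ({g. F g \<noteq> 0} - {P, Q})" by (intro card_mono) simp_all
    also have "\<dots> \<le> 2 * d + 1" using Suc.prems(2) PQ by (simp add: card_Diff_subset)
    finally obtain m s where m: "m \<noteq> 0" "\<And>g. F' g \<noteq> 0 \<Longrightarrow> form m g = s"
      using Suc.IH[OF kills'] by blast
    show ?thesis
    proof (cases "\<forall>g. F' g = 0")
      case True
      then have "form e g = form e P" if "F g \<noteq> 0" for g
        using that unfolding F'_def by (metis mult_eq_0_iff right_minus_eq)
      with e show ?thesis by blast
    next
      case False
      then have "\<not> card {g. F' g \<noteq> 0} \<le> Suc d"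
        using kills_degree_few_points[OF kills'] by blast
      define F'' where "F'' = (\<lambda>g. F g * (form m g - s))"
      have kills'': "kills_degree d F''"
        unfolding F''_def by (rule kills_degree_times_line[OF Suc.prems(1)])
      have "{g. F'' g \<noteq> 0} \<subseteq> {g. F g \<noteq> 0} - {g. F' g \<noteq> 0}" using m by (auto simp: F''_def)
      then have "card {g. F'' g \<noteq> 0} \<le> card ({g. F g \<noteq> 0} - {g. F' g \<noteq> 0})"
        by (intro card_mono) simp_all
      also have "\<dots> = card {g. F g \<noteq> 0} - card {g. F' g \<noteq> 0}"
        by (rule card_Diff_subset) (auto simp: F'_def)
      also have "\<dots> \<le> Suc d"
        using Suc.prems(2) \<open>\<not> card {g. F' g \<noteq> 0} \<le> Suc d\<close> by simp
      finally have "F'' g = 0" for g by (rule kills_degree_few_points[OF kills''])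
      then have "form m g = s" if "F g \<noteq> 0" for g
        using that unfolding F''_def by (metis mult_eq_0_iff right_minus_eq)
      with m show ?thesis by blast
    qed
  qed
qed

section \<open>Integer-valued functions with few support points and many constant fibre sums\<close>

lemma power_sum_mod_ring:
  assumes "k < CARD('p) - 1"
  shows "(\<Sum>t\<in>UNIV. t ^ k) = (0 :: 'p::prime_card mod_ring)"
proof (cases "k = 0")
  case True
  then show ?thesis by simp
next
  case False
  let ?q = "monom 1 k - 1 :: 'p mod_ring poly"
  have "coeff ?q k = 1" using False by (simp add: coeff_1)
  then have "?q \<noteq> 0" by (metis coeff_0 zero_neq_one)
  then have "card {u. poly ?q u = 0} \<le> degree ?q" by (rule card_poly_roots_bound)
  also have "\<dots> \<le> k" by (rule degree_diff_le) (simp_all add: degree_monom_le)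
  also have "\<dots> < card (UNIV - {0 :: 'p mod_ring})" using assms by (simp add: card_Diff_subset)
  finally have "\<not> UNIV - {0} \<subseteq> {u. poly ?q u = 0}"
    using card_mono[of "{u. poly ?q u = 0}" "UNIV - {0}"] by (meson finite leD)
  then obtain u :: "'p mod_ring" where u: "u \<noteq> 0" "u ^ k \<noteq> 1"
    by (auto simp: poly_monom)
  have "inj ((*) u)" using u(1) by (simp add: inj_def)
  then have "bij ((*) u)" by (simp add: bij_def finite_UNIV_inj_surj)
  then have "(\<Sum>t\<in>UNIV. t ^ k) = (\<Sum>t\<in>UNIV. (u * t) ^ k)"
    using sum.reindex_bij_betw[of "(*) u" UNIV UNIV "\<lambda>t. t ^ k"] by simp
  also have "\<dots> = u ^ k * (\<Sum>t\<in>UNIV. t ^ k)"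
    by (simp add: power_mult_distrib sum_distrib_left)
  finally have "(u ^ k - 1) * (\<Sum>t\<in>UNIV. t ^ k) = 0" by (simp add: algebra_simps)
  with u(2) show ?thesis by simp
qed

text \<open>If the fibre sums in a direction \<open>d\<close> are constant, then \<open>F\<close> is orthogonal to all powers
  \<open>(form d)^k\<close> with \<open>k < p - 1\<close>, since the \<open>k\<close>-th power sum over the field vanishes. For fixed \<open>k\<close> this
  inner product is a binary form of degree \<open>k\<close> in \<open>d\<close> whose coefficients are, up to invertible
  binomial coefficients, the moments of \<open>F\<close> of degree \<open>k\<close>; more than \<open>k\<close> projective zeros force all
  of them to vanish.\<close>
lemma kills_degree_of_fibre_sums:
  fixes F :: "'p::prime_card mod_ring \<times> 'p mod_ring \<Rightarrow> 'p mod_ring"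
  assumes N: "N \<subseteq> directions" "Suc n \<le> card N" "card N \<le> CARD('p) - 1"
    and fib: "\<And>d t. d \<in> N \<Longrightarrow> fibre_sum F d t = c"
  shows "kills_degree n F"
  unfolding kills_degree_def
proof (intro allI impI)
  fix i j assume ij: "i + j \<le> n"
  define k where "k = i + j"
  have k: "k < card N" "k < CARD('p) - 1" using ij N by (simp_all add: k_def)
  define M where "M = (\<lambda>l. \<Sum>g\<in>UNIV. F g * fst g ^ (k - l) * snd g ^ l)"
  \<comment> \<open>The binary form, dehomogenised at \<open>d = (1, b)\<close>; the direction \<open>(0, 1)\<close> is its zero at infinity
      and shows up as a drop of the degree.\<close>
  define R where "R = (\<Sum>l\<le>k. monom (of_nat (k choose l) * M l) l)"
  have coeffR: "coeff R l = (if l \<le> k then of_nat (k choose l) * M l else 0)" for l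
    by (simp add: R_def coeff_sum)
  have power_zero: "(\<Sum>g\<in>UNIV. F g * form d g ^ k) = 0" if "d \<in> N" for d
  proof -
    have "(\<Sum>g\<in>UNIV. F g * form d g ^ k) = (\<Sum>t\<in>UNIV. c * t ^ k)"
      using sum_fibre_sum[of F "\<lambda>t. t ^ k" d] fib[OF that] by simp
    also have "\<dots> = 0" using power_sum_mod_ring[OF k(2)] by (simp flip: sum_distrib_left)
    finally show ?thesis .
  qed
  have "poly R b = (\<Sum>g\<in>UNIV. F g * form (1, b) g ^ k)" for b
  proof -
    have "(\<Sum>g\<in>UNIV. F g * form (1, b) g ^ k)
        = (\<Sum>g\<in>UNIV. \<Sum>l\<le>k. of_nat (k choose l) * (F g * fst g ^ (k - l) * snd g ^ l) * b ^ l)"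
    proof (rule sum.cong[OF refl])
      fix g
      have "form (1, b) g ^ k = (b * snd g + fst g) ^ k" by (simp add: form_def add.commute)
      also have "\<dots> = (\<Sum>l\<le>k. of_nat (k choose l) * (b * snd g) ^ l * fst g ^ (k - l))"
        by (rule binomial_ring)
      finally show "F g * form (1, b) g ^ k
          = (\<Sum>l\<le>k. of_nat (k choose l) * (F g * fst g ^ (k - l) * snd g ^ l) * b ^ l)"
        by (simp add: sum_distrib_left power_mult_distrib mult_ac)
    qed
    also have "\<dots> = (\<Sum>l\<le>k. of_nat (k choose l) * M l * b ^ l)"
      unfolding M_def by (subst sum.swap) (simp add: sum_distrib_left sum_distrib_right)
    finally show ?thesis by (simp add: R_def poly_sum poly_monom)
  qed
  then have roots: "{b. (1, b) \<in> N} \<subseteq> {b. poly R b = 0}" using power_zero by auto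
  have "R = 0"
  proof (rule ccontr)
    assume "R \<noteq> 0"
    have "degree R \<le> k" by (rule degree_le) (simp add: coeffR)
    have card_slopes: "card {b. (1, b) \<in> N} \<le> degree R"
      using card_mono[OF _ roots] card_poly_roots_bound[OF \<open>R \<noteq> 0\<close>] by simp
    have img: "card (Pair (1 :: 'p mod_ring) ` {b. (1, b) \<in> N}) = card {b. (1, b) \<in> N}"
      by (intro card_image inj_onI) simp
    show False
    proof (cases "(0, 1) \<in> N")
      case False
      then have "N = Pair (1 :: 'p mod_ring) ` {b. (1, b) \<in> N}" using N(1) by (auto simp: directions_def)
      then have "card N = card (Pair (1 :: 'p mod_ring) ` {b. (1, b) \<in> N})" by (rule arg_cong[of _ _ card])
      then show False using img card_slopes \<open>degree R \<le> k\<close> k(1) by linarith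
    next
      case True
      then have "N = insert (0, 1) (Pair (1 :: 'p mod_ring) ` {b. (1, b) \<in> N})"
        using N(1) by (auto simp: directions_def)
      then have "card N = card (insert (0, 1) (Pair (1 :: 'p mod_ring) ` {b. (1, b) \<in> N}))" by (rule arg_cong[of _ _ card])
      also have "\<dots> \<le> Suc (card {b. (1, b) \<in> N})" using img by (simp add: card_insert_if)
      finally have "degree R = k" using card_slopes \<open>degree R \<le> k\<close> k(1) by linarith
      moreover have "coeff R k = 0"
        using power_zero[OF True] by (simp add: coeffR M_def form_def)
      ultimately show False using \<open>R \<noteq> 0\<close> by (metis leading_coeff_0_iff)
    qed
  qed
  then have "of_nat (k choose j) * M j = 0" using coeffR[of j] by (simp add: k_def)
  moreover have "of_nat (k choose j) \<noteq> (0 :: 'p mod_ring)"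
  proof
    assume "of_nat (k choose j) = (0 :: 'p mod_ring)"
    then have "CARD('p) dvd (k choose j)" by (rule of_nat_0_mod_ring_dvd)
    moreover have "(k choose j) dvd fact k"
      using binomial_fact_lemma[of j k] by (metis dvd_triv_right k_def le_add2)
    ultimately have "CARD('p) dvd fact k" by (rule dvd_trans)
    then show False using k(2) prime_dvd_fact_iff[OF prime_card[where 'a = 'p], of k] by simp
  qed
  ultimately have "M j = 0" by simp
  then show "(\<Sum>g\<in>UNIV. F g * fst g ^ i * snd g ^ j) = 0" by (simp add: M_def k_def)
qed

lemma of_int_mod_ring_eq_0_iff:
  "of_int c = (0 :: 'p::prime_card mod_ring) \<longleftrightarrow> int CARD('p) dvd c"
  by (simp add: of_int_eq_0_iff_char_dvd)

text \<open>The crucial step: if the support is smaller than twice the number of directions with constant fibre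
  sums, then a function not divisible by \<open>p\<close> is modulo \<open>p\<close> a nonzero constant on one line
  and vanishes elsewhere. Collinearity of the support comes from orthogonality to polynomials; a
  direction transversal to that line then shows that the values on the line all equal the common fibre
  sum.\<close>
lemma few_points_mod_p:
  fixes f :: "'p::prime_card mod_ring \<times> 'p mod_ring \<Rightarrow> int"
  assumes N: "N \<subseteq> directions" "card N \<le> CARD('p) - 1"
    and fib: "\<And>d t. d \<in> N \<Longrightarrow> fibre_sum f d t = c"
    and few: "card {g. f g \<noteq> 0} < 2 * card N"
    and primitive: "\<not> (\<forall>g. int CARD('p) dvd f g)"
  obtains e s where "e \<noteq> 0" "of_int c \<noteq> (0 :: 'p mod_ring)"
    "\<And>g. of_int (f g) = (if form e g = s then of_int c else (0 :: 'p mod_ring))"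
proof -
  define F where "F = (\<lambda>g. of_int (f g) :: 'p mod_ring)"
  obtain n where n: "card N = Suc n" using few by (cases "card N") auto
  have fibF: "fibre_sum F d t = of_int c" if "d \<in> N" for d t
    using fib[OF that, of t, symmetric] by (simp add: fibre_sum_def F_def)
  have kills: "kills_degree n F"
    using N n fibF by (intro kills_degree_of_fibre_sums[of N]) simp_all
  have "card {g. F g \<noteq> 0} \<le> card {g. f g \<noteq> 0}"
    by (intro card_mono) (auto simp: F_def)
  then have few': "card {g. F g \<noteq> 0} \<le> 2 * n + 1" using few n by simp
  obtain g0 where g0: "F g0 \<noteq> 0"
    using primitive by (auto simp: F_def of_int_mod_ring_eq_0_iff)
  obtain e s where e: "e \<noteq> 0" "\<And>g. F g \<noteq> 0 \<Longrightarrow> form e g = s"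
    using kills_degree_collinear[OF kills few'] by blast
  have "n \<noteq> 0"
  proof
    assume "n = 0"
    then have "card {g. F g \<noteq> 0} \<le> Suc n" using few' by simp
    with kills_degree_few_points[OF kills] g0 show False by blast
  qed
  have "\<exists>d\<in>N. det2 d e \<noteq> 0"
  proof (rule ccontr)
    assume "\<not> ?thesis"
    then have "d = d'" if "d \<in> N" "d' \<in> N" for d d'
      using that N(1) directions_parallel_unique[OF e(1), of d d'] by blast
    then have "card N \<le> Suc 0" using card_le_Suc0_iff_eq[OF finite, of N] by blast
    with n \<open>n \<noteq> 0\<close> show False by simp
  qed
  then obtain d where d: "d \<in> N" "det2 d e \<noteq> 0" by blast
  have on: "F g = of_int c" if "form e g = s" for g
  proof -
    obtain h where h: "{x. form d x = form d g \<and> form e x = s} = {h}"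
      using lines_meet_in_point[OF d(2)] .
    moreover have "g \<in> {x. form d x = form d g \<and> form e x = s}" using that by simp
    ultimately have "h = g" by simp
    have "of_int c = fibre_sum F d (form d g)" using fibF[OF d(1)] by simp
    also have "\<dots> = sum F {x. form d x = form d g \<and> form e x = s}"
      unfolding fibre_sum_def by (rule sum.mono_neutral_right) (use e(2) in auto)
    also have "\<dots> = F g" unfolding h \<open>h = g\<close> by simp
    finally show ?thesis ..
  qed
  show ?thesis
  proof (rule that)
    show "e \<noteq> 0" by (rule e(1))
    show "of_int c \<noteq> (0 :: 'p mod_ring)" using on e(2) g0 by metis
    show "of_int (f g) = (if form e g = s then of_int c else (0 :: 'p mod_ring))" for g
      using on[of g] e(2)[of g] unfolding F_def by metis
  qed
qed

lemma primitive_multiple: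
  fixes f :: "'g \<Rightarrow> int"
  assumes "f g0 \<noteq> 0" and q: "\<bar>q\<bar> \<noteq> 1"
  obtains G f' where "G \<noteq> 0" "\<And>g. f g = G * f' g" "\<not> (\<forall>g. q dvd f' g)"
proof -
  define G where "G = Gcd (range f)"
  have "G \<noteq> 0" unfolding G_def using assms(1) by (auto simp: Gcd_0_iff)
  have G: "G dvd f g" for g unfolding G_def by (rule Gcd_dvd) simp
  define f' where "f' = (\<lambda>g. f g div G)"
  have f: "f g = G * f' g" for g using G[of g] by (simp add: f'_def)
  have "\<not> (\<forall>g. q dvd f' g)"
  proof
    assume "\<forall>g. q dvd f' g"
    then have "G * q dvd f g" for g unfolding f by (simp add: mult_dvd_mono)
    then have "G * q dvd Gcd (range f)" by (intro Gcd_greatest) blast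
    then have "G * q dvd G * 1" by (simp add: G_def)
    then have "q dvd 1" using \<open>G \<noteq> 0\<close> by (metis dvd_mult_cancel_left)
    with q show False by simp
  qed
  with \<open>G \<noteq> 0\<close> f show ?thesis by (rule that)
qed

lemma fibre_sum_mult_left:
  fixes f :: "'a::{finite,comm_ring_1} \<times> 'a \<Rightarrow> 'b::comm_semiring_0"
  shows "fibre_sum (\<lambda>g. a * f g) d t = a * fibre_sum f d t"
  by (simp add: fibre_sum_def sum_distrib_left)

text \<open>Dividing by the content preserves all hypotheses and makes some value prime to \<open>p\<close>, which is what
  reduction modulo \<open>p\<close> needs.\<close>
lemma few_points_primitive:
  fixes f :: "'p::prime_card mod_ring \<times> 'p mod_ring \<Rightarrow> int"
  assumes N: "N \<subseteq> directions" "card N \<le> CARD('p) - 1"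
    and fib: "\<And>d t. d \<in> N \<Longrightarrow> fibre_sum f d t = c"
    and few: "card {g. f g \<noteq> 0} < 2 * card N"
    and "f g0 \<noteq> 0"
  obtains G f' c' where "G \<noteq> 0" "\<And>g. f g = G * f' g" "c = G * c'"
    "\<And>d t. d \<in> N \<Longrightarrow> fibre_sum f' d t = c'"
    "card {g. f' g \<noteq> 0} < 2 * card N" "\<not> (\<forall>g. int CARD('p) dvd f' g)"
proof -
  have "CARD('p) \<noteq> 1" using prime_card[where 'a = 'p] by (metis not_prime_1)
  then have q: "\<bar>int CARD('p)\<bar> \<noteq> 1" by simp
  obtain G f' where G: "G \<noteq> 0" "\<And>g. f g = G * f' g" "\<not> (\<forall>g. int CARD('p) dvd f' g)"
    using primitive_multiple[of f g0, OF \<open>f g0 \<noteq> 0\<close> q] by metis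
  have f: "f = (\<lambda>g. G * f' g)" using G(2) by blast
  have "N \<noteq> {}" using few by auto
  then obtain d0 where "d0 \<in> N" by blast
  define c' where "c' = fibre_sum f' d0 0"
  have c: "c = G * c'"
    using fib[OF \<open>d0 \<in> N\<close>, of 0] unfolding f fibre_sum_mult_left c'_def by simp
  have fib': "fibre_sum f' d t = c'" if "d \<in> N" for d t
    using fib[OF that, of t] G(1) unfolding f fibre_sum_mult_left c by simp
  have few': "card {g. f' g \<noteq> 0} < 2 * card N"
    using few G(1) unfolding f by simp
  show ?thesis by (rule that[OF G(1,2) c fib' few' G(3)])
qed

lemma few_points_sum_zero:
  fixes f :: "'p::prime_card mod_ring \<times> 'p mod_ring \<Rightarrow> int"
  assumes N: "N \<subseteq> directions" "card N \<le> CARD('p) - 1"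
    and fib: "\<And>d t. d \<in> N \<Longrightarrow> fibre_sum f d t = 0"
    and few: "card {g. f g \<noteq> 0} < 2 * card N"
  shows "f g = 0"
proof (rule ccontr)
  assume "f g \<noteq> 0"
  obtain G f' c' where G: "G \<noteq> 0" "\<And>g. f g = G * f' g" "0 = G * c'"
    "\<And>d t. d \<in> N \<Longrightarrow> fibre_sum f' d t = c'"
    "card {g. f' g \<noteq> 0} < 2 * card N" "\<not> (\<forall>g. int CARD('p) dvd f' g)"
    using few_points_primitive[OF N fib few \<open>f g \<noteq> 0\<close>] by metis
  have "of_int c' \<noteq> (0 :: 'p mod_ring)"
    using few_points_mod_p[OF N G(4,5,6)] by metis
  moreover have "c' = 0" using G(1,3) by simp
  ultimately show False by simp
qed

text \<open>The same conclusion over the integers. Subtracting the multiple of the indicator of the line found modulo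
  \<open>p\<close> keeps the support within the old one and makes all fibre sums zero, so that nothing is left.\<close>
lemma few_points_line:
  fixes f :: "'p::prime_card mod_ring \<times> 'p mod_ring \<Rightarrow> int"
  assumes N: "N \<subseteq> directions" "card N \<le> CARD('p) - 1"
    and fib: "\<And>d t. d \<in> N \<Longrightarrow> fibre_sum f d t = c"
    and few: "card {g. f g \<noteq> 0} < 2 * card N"
    and "f g0 \<noteq> 0"
  obtains e s where "e \<noteq> 0" "\<And>g. f g = (if form e g = s then c else 0)"
proof -
  obtain G f' c' where G: "G \<noteq> 0" "\<And>g. f g = G * f' g" "c = G * c'"
    and fib': "\<And>d t. d \<in> N \<Longrightarrow> fibre_sum f' d t = c'"
    and few': "card {g. f' g \<noteq> 0} < 2 * card N"
    and prim: "\<not> (\<forall>g. int CARD('p) dvd f' g)"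
    using few_points_primitive[OF N fib few \<open>f g0 \<noteq> 0\<close>] by metis
  obtain e s where e: "e \<noteq> 0" and c': "of_int c' \<noteq> (0 :: 'p mod_ring)"
    and f': "\<And>g. of_int (f' g) = (if form e g = s then of_int c' else (0 :: 'p mod_ring))"
    using few_points_mod_p[OF N fib' few' prim] by metis
  let ?l = "\<lambda>g. if form e g = s then c' else 0"
  \<comment> \<open>Otherwise the line itself would be a fibre, with sum \<open>p c' = 0\<close> modulo \<open>p\<close>, and not \<open>c'\<close>.\<close>
  have not_parallel: "det2 d e \<noteq> 0" if "d \<in> N" for d
  proof
    assume "det2 d e = 0"
    moreover have "d \<noteq> 0" using that N(1) directions_nonzero by blast
    ultimately obtain u where u: "u \<noteq> 0" "\<And>g. form d g = u * form e g"
      using parallel_forms e by metis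
    have "of_int c' = (\<Sum>g | form d g = u * s. of_int (f' g) :: 'p mod_ring)"
      using fib'[OF that, of "u * s"] by (simp add: fibre_sum_def flip: of_int_sum)
    also have "\<dots> = (\<Sum>g | form e g = s. of_int c')"
      by (rule sum.cong) (use u f' in auto)
    also have "\<dots> = 0" using card_fibre[OF e, of s] by simp
    finally show False using c' by simp
  qed
  have zero: "f' g - ?l g = 0" for g
  proof (rule few_points_sum_zero[OF N])
    show "fibre_sum (\<lambda>g. f' g - ?l g) d t = 0" if "d \<in> N" for d t
    proof -
      have "fibre_sum (\<lambda>g. f' g - ?l g) d t = fibre_sum f' d t - fibre_sum ?l d t"
        by (simp only: fibre_sum_def sum_subtractf)
      also have "\<dots> = 0" by (simp only: fib'[OF that] fibre_sum_line[OF not_parallel[OF that]] diff_self)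
      finally show ?thesis .
    qed
    have "f' g \<noteq> 0" if "form e g = s" for g using f'[of g] c' that by auto
    then have "{g. f' g - ?l g \<noteq> 0} \<subseteq> {g. f' g \<noteq> 0}" by auto
    then have "card {g. f' g - ?l g \<noteq> 0} \<le> card {g. f' g \<noteq> 0}" by (intro card_mono) simp_all
    then show "card {g. f' g - ?l g \<noteq> 0} < 2 * card N" using few' by simp
  qed
  have "f g = (if form e g = s then c else 0)" for g
    using zero[of g] by (simp add: G(2,3))
  with e show ?thesis by (rule that)
qed

section \<open>The characters of the plane\<close>

text \<open>The additive character of the prime field sending \<open>1\<close> to \<open>exp (2 \<pi> \<i> / p)\<close>.\<close>
definition add_char :: "'p::prime_card mod_ring \<Rightarrow> complex" where
  "add_char t = cis (2 * pi / real CARD('p)) ^ nat (to_int_mod_ring t)"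

lemma cis_power_card: "cis (2 * pi / real CARD('p::prime_card)) ^ CARD('p) = 1"
  by (simp add: Complex.DeMoivre)

lemma add_char_of_nat:
  "add_char (of_nat k :: 'p::prime_card mod_ring) = cis (2 * pi / real CARD('p)) ^ k"
proof -
  let ?w = "cis (2 * pi / real CARD('p))"
  have "to_int_mod_ring (of_nat k :: 'p mod_ring) = int k mod int CARD('p)"
    unfolding of_nat_of_int_mod_ring o_def by transfer simp
  then have "add_char (of_nat k :: 'p mod_ring) = ?w ^ (k mod CARD('p))"
    by (simp add: add_char_def flip: zmod_int)
  also have "\<dots> = ?w ^ (k mod CARD('p)) * (?w ^ CARD('p)) ^ (k div CARD('p))"
    by (simp only: cis_power_card power_one mult_1_right)
  also have "\<dots> = ?w ^ k"
    by (simp only: flip: power_mult power_add) simp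
  finally show ?thesis .
qed

lemma mod_ring_of_nat_cases:
  obtains k where "k < CARD('p)" "(t :: 'p::prime_card mod_ring) = of_nat k"
  using surj_of_nat_mod_ring[of t] by blast

lemma add_char_zero [simp]: "add_char 0 = 1"
  using add_char_of_nat[of 0] by simp

lemma add_char_add: "add_char (s + t) = add_char s * add_char t"
proof -
  obtain i where i: "s = of_nat i" by (rule mod_ring_of_nat_cases)
  obtain j where j: "t = of_nat j" by (rule mod_ring_of_nat_cases)
  show ?thesis
    unfolding i j of_nat_add[symmetric] add_char_of_nat by (rule power_add)
qed

lemma add_char_of_nat_mult: "add_char (of_nat k * t) = add_char t ^ k"
  by (induction k) (simp_all add: add_char_add distrib_right)

lemma roots_of_unity_powers:
  "bij_betw (\<lambda>k. cis (2 * pi / real CARD('p::prime_card)) ^ k) {..<CARD('p)} {z. z ^ CARD('p) = 1}"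
proof -
  have "(\<lambda>k. cis (2 * pi / real CARD('p)) ^ k) = (\<lambda>k. cis (2 * pi * real k / real CARD('p)))"
    by (rule ext) (simp add: Complex.DeMoivre mult_ac)
  then show ?thesis using Complex.bij_betw_roots_unity[of "CARD('p)"] by auto
qed

lemma add_char_eq_1_iff: "add_char (t :: 'p::prime_card mod_ring) = 1 \<longleftrightarrow> t = 0"
proof
  assume t: "add_char t = 1"
  obtain k where k: "k < CARD('p)" "t = of_nat k" by (rule mod_ring_of_nat_cases)
  have "k = 0"
    using roots_of_unity_powers[where 'p = 'p, THEN bij_betw_imp_inj_on, THEN inj_onD, of k 0]
      t k by (simp add: add_char_of_nat)
  with k show "t = 0" by simp
qed simp

lemma root_of_unity_add_char:
  assumes "z ^ CARD('p::prime_card) = 1"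
  obtains a :: "'p::prime_card mod_ring" where "z = add_char a"
proof -
  have "z \<in> (\<lambda>k. cis (2 * pi / real CARD('p)) ^ k) ` {..<CARD('p)}"
    using bij_betw_imp_surj_on[OF roots_of_unity_powers[where 'p = 'p]] assms by simp
  then obtain k where "z = add_char (of_nat k :: 'p mod_ring)" by (auto simp: add_char_of_nat)
  then show ?thesis by (rule that)
qed

text \<open>The character of the plane attached to the coefficient vector \<open>d\<close>; \<open>d \<mapsto> plane_char d\<close> identifies the
  plane with its dual group.\<close>
definition plane_char :: "'p::prime_card mod_ring \<times> 'p mod_ring \<Rightarrow> 'p mod_ring \<times> 'p mod_ring \<Rightarrow> complex" where
  "plane_char d g = add_char (form d g)"

lemma plane_char_in_characters: "plane_char d \<in> characters"
  by (simp add: characters_def plane_char_def form_add add_char_add del: split_paired_All)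

lemma characters_eq_range_plane_char:
  "(characters :: ('p::prime_card mod_ring \<times> 'p mod_ring \<Rightarrow> complex) set) = range plane_char"
proof (intro equalityI subsetI)
  fix \<psi> :: "'p mod_ring \<times> 'p mod_ring \<Rightarrow> complex"
  assume "\<psi> \<in> characters"
  then have zero: "\<psi> 0 = 1" and add: "\<psi> (g + h) = \<psi> g * \<psi> h" for g h
    unfolding characters_def by blast+
  have x: "\<psi> (of_nat k, 0) = \<psi> (1, 0) ^ k" for k
    by (induction k) (use zero add[of "(1, 0)" "(of_nat k, 0)" for k] in \<open>simp_all add: zero_prod_def\<close>)
  have y: "\<psi> (0, of_nat k) = \<psi> (0, 1) ^ k" for k
    by (induction k) (use zero add[of "(0, 1)" "(0, of_nat k)" for k] in \<open>simp_all add: zero_prod_def\<close>)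
  obtain a :: "'p mod_ring" where a: "\<psi> (1, 0) = add_char a"
    using root_of_unity_add_char x[of "CARD('p)"] zero by (metis of_nat_card_eq_0 zero_prod_def)
  obtain b :: "'p mod_ring" where b: "\<psi> (0, 1) = add_char b"
    using root_of_unity_add_char y[of "CARD('p)"] zero by (metis of_nat_card_eq_0 zero_prod_def)
  have "\<psi> g = plane_char (a, b) g" for g
  proof -
    obtain i where i: "fst g = of_nat i" by (rule mod_ring_of_nat_cases)
    obtain j where j: "snd g = of_nat j" by (rule mod_ring_of_nat_cases)
    have "\<psi> g = \<psi> (of_nat i, 0) * \<psi> (0, of_nat j)"
      unfolding add[symmetric] by (simp flip: i j)
    also have "\<dots> = plane_char (a, b) g"
      unfolding x y a b plane_char_def form_def add_char_add fst_conv snd_conv i j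
      by (simp add: mult.commute[of _ "of_nat _"] add_char_of_nat_mult)
    finally show ?thesis .
  qed
  then show "\<psi> \<in> range plane_char" by blast
qed (use plane_char_in_characters in blast)

lemma inj_plane_char: "inj (plane_char :: 'p::prime_card mod_ring \<times> 'p mod_ring \<Rightarrow> _)"
proof (rule injI)
  fix d e :: "'p mod_ring \<times> 'p mod_ring"
  assume eq: "plane_char d = plane_char e"
  have "s = t" if "add_char s = add_char t" for s t :: "'p mod_ring"
  proof -
    have "add_char (s - t) * add_char t = add_char t" using that by (simp flip: add_char_add)
    moreover have "add_char t * add_char (- t) = 1" by (simp flip: add_char_add)
    ultimately have "add_char (s - t) = 1" by (metis mult_cancel_right1 mult_zero_left zero_neq_one)
    then show ?thesis by (simp add: add_char_eq_1_iff)
  qed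
  then have "form d g = form e g" for g
    using fun_cong[OF eq, of g] by (simp add: plane_char_def)
  from this[of "(1, 0)"] this[of "(0, 1)"] show "d = e" by (simp add: form_def prod_eq_iff)
qed

lemma bij_of_nat_mod_ring: "bij_betw of_nat {..<CARD('p)} (UNIV :: 'p::prime_card mod_ring set)"
  unfolding bij_betw_def
proof
  show surj: "of_nat ` {..<CARD('p)} = (UNIV :: 'p mod_ring set)"
    by (auto intro: mod_ring_of_nat_cases)
  show "inj_on (of_nat :: nat \<Rightarrow> 'p mod_ring) {..<CARD('p)}"
    by (rule eq_card_imp_inj_on) (simp_all add: surj)
qed

section \<open>Null directions and the Fourier support\<close>

text \<open>A direction is null when the function is equidistributed over its lines. All nonzero multiples of \<open>d\<close>
  have the same lines, so for rational-valued functions the Fourier transform vanishes on the whole punctured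
  line of characters as soon as it vanishes at one of them.\<close>
definition null_direction :: "('p::prime_card mod_ring \<times> 'p mod_ring \<Rightarrow> int) \<Rightarrow> 'p mod_ring \<times> 'p mod_ring \<Rightarrow> bool" where
  "null_direction \<phi> d \<longleftrightarrow> (\<forall>s t. fibre_sum \<phi> d s = fibre_sum \<phi> d t)"

lemma null_direction_of_fourier_zero:
  fixes f :: "'p::prime_card mod_ring \<times> 'p mod_ring \<Rightarrow> complex"
  assumes q: "\<And>g. of_int q * f g = of_int (\<phi> g)"
    and zero: "fourier f (plane_char d) = 0"
  shows "null_direction \<phi> d"
proof -
  let ?w = "cis (2 * pi / real CARD('p))"
  have "(\<Sum>g\<in>UNIV. f g * cnj (add_char (form d g))) = 0"
    using zero by (simp add: fourier_def plane_char_def)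
  then have "of_int q * (\<Sum>g\<in>UNIV. f g * cnj (add_char (form d g))) = 0" by simp
  then have "0 = (\<Sum>g\<in>UNIV. of_int (\<phi> g) * cnj (add_char (form d g)))"
    by (simp add: sum_distrib_left mult.assoc flip: q)
  also have "\<dots> = (\<Sum>t\<in>UNIV. fibre_sum (\<lambda>g. of_int (\<phi> g)) d t * cnj (add_char t))"
    by (rule sum_fibre_sum)
  also have "\<dots> = (\<Sum>k<CARD('p). fibre_sum (\<lambda>g. of_int (\<phi> g)) d (of_nat k) * cnj (add_char (of_nat k :: 'p mod_ring)))"
    by (rule sum.reindex_bij_betw[OF bij_of_nat_mod_ring, symmetric])
  also have "\<dots> = (\<Sum>k<CARD('p). of_int (fibre_sum \<phi> d (of_nat k)) * cnj ?w ^ k)"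
    by (simp add: add_char_of_nat fibre_sum_def)
  \<comment> \<open>A relation with integer coefficients among the \<open>p\<close>-th roots of unity: the coefficients are the fibre sums.\<close>
  finally have rel: "(\<Sum>k<CARD('p). of_int (fibre_sum \<phi> d (of_nat k)) * cnj ?w ^ k) = 0" ..
  have "cnj ?w \<noteq> 1"
  proof
    assume "cnj ?w = 1"
    then have "?w = 1" by (metis complex_cnj_cnj complex_cnj_one)
    then have "add_char (1 :: 'p mod_ring) = 1" using add_char_of_nat[of 1, where 'p = 'p] by simp
    then show False by (simp add: add_char_eq_1_iff)
  qed
  moreover have "cnj ?w ^ CARD('p) = 1"
    by (metis cis_power_card complex_cnj_one complex_cnj_power)
  ultimately have "(\<Sum>k<CARD('p). cnj ?w ^ k) = 0"
    using power_diff_1_eq[of "cnj ?w" "CARD('p)"] by simp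
  note eq = coeffs_eq_of_root_all_ones_poly[OF this rel]
  show ?thesis unfolding null_direction_def
  proof (intro allI)
    fix s t :: "'p mod_ring"
    obtain i where i: "i < CARD('p)" "s = of_nat i" by (rule mod_ring_of_nat_cases)
    obtain j where j: "j < CARD('p)" "t = of_nat j" by (rule mod_ring_of_nat_cases)
    show "fibre_sum \<phi> d s = fibre_sum \<phi> d t" using eq[OF i(1) j(1)] i(2) j(2) by simp
  qed
qed

lemma null_direction_sum:
  fixes \<phi> :: "'p::prime_card mod_ring \<times> 'p mod_ring \<Rightarrow> int"
  assumes "null_direction \<phi> d"
  shows "int CARD('p) * fibre_sum \<phi> d t = sum \<phi> UNIV"
proof -
  have "sum \<phi> UNIV = (\<Sum>s\<in>UNIV. fibre_sum \<phi> d s)"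
    using sum_fibre_sum[of \<phi> "\<lambda>_. 1" d] by simp
  also have "\<dots> = (\<Sum>s\<in>(UNIV :: 'p mod_ring set). fibre_sum \<phi> d t)"
    using assms by (intro sum.cong) (auto simp: null_direction_def)
  finally show ?thesis by simp
qed

lemma common_denominator:
  fixes f :: "'g::finite \<Rightarrow> complex"
  assumes "\<And>g. f g \<in> \<rat>"
  obtains q \<phi> where "q \<noteq> 0" "\<And>g. of_int q * f g = of_int (\<phi> g)"
proof -
  have "\<exists>a b. b \<noteq> 0 \<and> of_int b * f g = of_int a" for g
  proof -
    obtain r where "f g = of_rat r" using assms[of g] by (auto simp: Rats_def)
    moreover obtain a b where "r = of_int a / of_int b" "b \<noteq> 0"
      by (metis quotient_of_div quotient_of_denom_pos less_irrefl surj_pair)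
    ultimately show ?thesis by (intro exI[of _ a] exI[of _ b]) (simp add: of_rat_divide)
  qed
  then obtain a b where ab: "\<And>g. b g \<noteq> 0" "\<And>g. of_int (b g) * f g = of_int (a g)" by metis
  show ?thesis
  proof (rule that[of "prod b UNIV" "\<lambda>g. prod b (UNIV - {g}) * a g"])
    show "prod b UNIV \<noteq> 0" using ab(1) by simp
    fix g
    have "prod b UNIV = b g * prod b (UNIV - {g})" by (rule prod.remove) simp_all
    then have "prod b UNIV = prod b (UNIV - {g}) * b g" by (simp only: mult.commute)
    then have "of_int (prod b UNIV) * f g = of_int (prod b (UNIV - {g})) * (of_int (b g) * f g)"
      by (simp only: of_int_mult mult.assoc)
    also have "\<dots> = of_int (prod b (UNIV - {g}) * a g)"
      by (simp only: ab(2) of_int_mult)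
    finally show "of_int (prod b UNIV) * f g = of_int (prod b (UNIV - {g}) * a g)" .
  qed
qed

text \<open>Each non-null direction contributes \<open>p - 1\<close> characters to the Fourier support.\<close>
lemma card_fourier_supp_ge:
  fixes f :: "'p::prime_card mod_ring \<times> 'p mod_ring \<Rightarrow> complex"
  assumes q: "\<And>g. of_int q * f g = of_int (\<phi> g)"
  shows "(CARD('p) - 1) * card {d \<in> directions. \<not> null_direction \<phi> d} \<le> card (fourier_supp f)"
proof -
  let ?M = "{d \<in> directions. \<not> null_direction \<phi> d}"
  let ?m = "\<lambda>(k, d). (k * fst d, k * snd d) :: 'p mod_ring \<times> 'p mod_ring"
  have inj: "inj_on ?m ((UNIV - {0}) \<times> ?M)"
  proof (rule inj_onI)
    fix z z' assume z: "z \<in> (UNIV - {0}) \<times> ?M" "z' \<in> (UNIV - {0}) \<times> ?M" and m: "?m z = ?m z'"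
    obtain k d where kd: "z = (k, d)" by (rule prod.exhaust)
    obtain k' d' where kd': "z' = (k', d')" by (rule prod.exhaust)
    have k: "k \<noteq> 0" "k' \<noteq> 0" and D: "d \<in> directions" "d' \<in> directions"
      using z unfolding kd kd' by blast+
    have eq: "k * fst d = k' * fst d'" "k * snd d = k' * snd d'"
      using m unfolding kd kd' by simp_all
    have "k * k' * det2 d d' = (k * fst d) * (k' * snd d') - (k * snd d) * (k' * fst d')"
      by (simp add: det2_def algebra_simps)
    also have "\<dots> = 0" unfolding eq by (simp add: mult.commute)
    finally have "d = d'" using k directions_eqI[OF D] by simp
    moreover have "fst d' \<noteq> 0 \<or> snd d' \<noteq> 0"
      using directions_nonzero[OF D(2)] by (simp add: prod_eq_iff)
    ultimately have "k = k'" using eq by auto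
    with \<open>d = d'\<close> show "z = z'" by (simp add: kd kd')
  qed
  have "plane_char (?m (k, d)) \<in> fourier_supp f" if "k \<noteq> 0" "d \<in> ?M" for k d
  proof (rule ccontr)
    assume "plane_char (?m (k, d)) \<notin> fourier_supp f"
    then have "fourier f (plane_char (?m (k, d))) = 0"
      using plane_char_in_characters by (auto simp: fourier_supp_def support_on_def)
    then have null: "null_direction \<phi> (?m (k, d))" by (rule null_direction_of_fourier_zero[OF q])
    have scale: "fibre_sum \<phi> d t = fibre_sum \<phi> (?m (k, d)) (k * t)" for t
    proof -
      have "form (?m (k, d)) g = k * t \<longleftrightarrow> form d g = t" for g
        using \<open>k \<noteq> 0\<close> by (simp add: form_def mult.assoc flip: distrib_left)
      then show ?thesis by (simp only: fibre_sum_def)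
    qed
    have "fibre_sum \<phi> d s = fibre_sum \<phi> d t" for s t
      unfolding scale using null unfolding null_direction_def by blast
    then have "null_direction \<phi> d" unfolding null_direction_def by blast
    with that(2) show False by simp
  qed
  then have "plane_char ` ?m ` ((UNIV - {0}) \<times> ?M) \<subseteq> fourier_supp f" by auto
  moreover have "finite (fourier_supp f)"
    by (rule finite_subset[of _ characters])
       (auto simp: fourier_supp_def support_on_def characters_eq_range_plane_char)
  ultimately have "card (plane_char ` ?m ` ((UNIV - {0}) \<times> ?M)) \<le> card (fourier_supp f)"
    by (rule card_mono[rotated])
  moreover have "card (plane_char ` ?m ` ((UNIV - {0}) \<times> ?M)) = (CARD('p) - 1) * card ?M"
    using card_image[OF inj] card_image[OF inj_on_subset[OF inj_plane_char[where 'p = 'p] subset_UNIV]]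
    by (simp add: card_cartesian_product card_Diff_subset)
  ultimately show ?thesis by simp
qed

text \<open>An inversion formula: the lines through \<open>g\<close> cover every other point exactly once and \<open>g\<close> itself
  \<open>p + 1\<close> times.\<close>
lemma sum_fibre_sums_through_point:
  fixes \<phi> :: "'p::prime_card mod_ring \<times> 'p mod_ring \<Rightarrow> int"
  shows "(\<Sum>d\<in>directions. fibre_sum \<phi> d (form d g)) = int CARD('p) * \<phi> g + sum \<phi> UNIV"
proof -
  have card: "card {d \<in> directions. form d h = form d g} = (if h = g then CARD('p) + 1 else 1)" for h
  proof (cases "h = g")
    case True
    then show ?thesis using card_directions[where 'a = "'p mod_ring"] by simp
  next
    case False
    then have ex1: "\<exists>!d. d \<in> directions \<and> form d (h - g) = 0"
      by (intro ex1_direction_through) simp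
    then obtain d where d: "d \<in> directions" "form d (h - g) = 0" by blast
    have "x = d" if "x \<in> directions" "form x h = form x g" for x
    proof -
      have "form x (h - g) = 0" using that(2) by (simp add: form_diff)
      with ex1 d that(1) show ?thesis by blast
    qed
    moreover have "form d h = form d g" using d(2) by (simp add: form_diff)
    ultimately have "{d \<in> directions. form d h = form d g} = {d}" using d(1) by blast
    with False show ?thesis by simp
  qed
  have "(\<Sum>d\<in>directions. fibre_sum \<phi> d (form d g))
      = (\<Sum>d\<in>directions. \<Sum>h\<in>UNIV. if form d h = form d g then \<phi> h else 0)"
    by (simp add: fibre_sum_def sum.If_cases)
  also have "\<dots> = (\<Sum>h\<in>UNIV. \<Sum>d\<in>directions. if form d h = form d g then \<phi> h else 0)"
    by (rule sum.swap)
  also have "\<dots> = (\<Sum>h\<in>UNIV. \<phi> h + (if h = g then int CARD('p) * \<phi> h else 0))"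
  proof (rule sum.cong[OF refl])
    fix h
    have "(\<Sum>d\<in>directions. if form d h = form d g then \<phi> h else 0)
        = int (card {d \<in> directions. form d h = form d g}) * \<phi> h"
      by (simp add: sum.If_cases Int_def)
    then show "(\<Sum>d\<in>directions. if form d h = form d g then \<phi> h else 0)
        = \<phi> h + (if h = g then int CARD('p) * \<phi> h else 0)"
      unfolding card by (simp add: algebra_simps)
  qed
  also have "\<dots> = int CARD('p) * \<phi> g + sum \<phi> UNIV"
    by (simp add: sum.distrib)
  finally show ?thesis .
qed

lemma constant_on_fibres:
  fixes \<phi> :: "'p::prime_card mod_ring \<times> 'p mod_ring \<Rightarrow> int"
  assumes d0: "d0 \<in> directions" and null: "\<And>d. d \<in> directions \<Longrightarrow> d \<noteq> d0 \<Longrightarrow> null_direction \<phi> d"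
    and "form d0 g = form d0 h"
  shows "\<phi> g = \<phi> h"
proof -
  have "fibre_sum \<phi> d (form d g) = fibre_sum \<phi> d (form d h)" if "d \<in> directions" for d
    using null[OF that] assms(3) unfolding null_direction_def by metis
  then have "(\<Sum>d\<in>directions. fibre_sum \<phi> d (form d g)) = (\<Sum>d\<in>directions. fibre_sum \<phi> d (form d h))"
    by (rule sum.cong[OF refl])
  then show ?thesis by (simp add: sum_fibre_sums_through_point)
qed

text \<open>A function with at least two non-null directions is not concentrated on a line as in the conclusion of
  \<open>few_points_line\<close>, because there only the direction of the line can fail to be null.\<close>
lemma card_supp_ge:
  fixes \<phi> :: "'p::prime_card mod_ring \<times> 'p mod_ring \<Rightarrow> int"
  defines "N \<equiv> {d \<in> directions. null_direction \<phi> d}"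
  assumes N: "card N \<le> CARD('p) - 1" and "\<phi> g0 \<noteq> 0"
  shows "2 * card N \<le> card {g. \<phi> g \<noteq> 0}"
proof (rule ccontr)
  assume "\<not> ?thesis"
  then have few: "card {g. \<phi> g \<noteq> 0} < 2 * card N" by simp
  then have "N \<noteq> {}" by auto
  then obtain d0 where "d0 \<in> N" by blast
  define c where "c = fibre_sum \<phi> d0 0"
  have fib: "fibre_sum \<phi> d t = c" if "d \<in> N" for d t
  proof -
    have "null_direction \<phi> d" "null_direction \<phi> d0" using that \<open>d0 \<in> N\<close> by (simp_all add: N_def)
    then have "int CARD('p) * fibre_sum \<phi> d t = int CARD('p) * c"
      unfolding c_def by (simp only: null_direction_sum)
    then show ?thesis by simp
  qed
  obtain e s where e: "e \<noteq> 0" and line: "\<And>g. \<phi> g = (if form e g = s then c else 0)"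
    using few_points_line[OF _ N fib few \<open>\<phi> g0 \<noteq> 0\<close>] unfolding N_def by blast
  have "null_direction \<phi> d" if "det2 d e \<noteq> 0" for d
    using fibre_sum_line[OF that, of s c] unfolding null_direction_def line[abs_def] by metis
  then have par: "det2 d e = 0" if "d \<in> directions - N" for d using that unfolding N_def by blast
  have "d = d'" if "d \<in> directions - N" "d' \<in> directions - N" for d d'
    using par[OF that(1)] par[OF that(2)] that directions_parallel_unique[OF e] by blast
  then have "card (directions - N) \<le> Suc 0"
    using card_le_Suc0_iff_eq[OF finite, of "directions - N"] by blast
  moreover have "card (directions - N) = CARD('p) + 1 - card N"
    unfolding card_directions[where 'a = "'p mod_ring", unfolded CARD_mod_ring, symmetric]
    by (rule card_Diff_subset) (auto simp: N_def)
  ultimately show False using N few by simp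
qed

section \<open>Exceptional subgroups\<close>

lemma fourier_zero_outside_perp:
  fixes f :: "'g::{finite,ab_group_add} \<Rightarrow> complex"
  assumes inv: "\<And>g h. h \<in> H \<Longrightarrow> f (g + h) = f g"
    and \<psi>: "\<psi> \<in> characters" "\<psi> \<notin> perp H"
  shows "fourier f \<psi> = 0"
proof -
  obtain h where h: "h \<in> H" "\<psi> h \<noteq> 1" using \<psi> by (auto simp: perp_def char_kernel_def)
  have mult: "\<psi> (g + g') = \<psi> g * \<psi> g'" for g g' using \<psi>(1) by (auto simp: characters_def)
  have "(\<Sum>g\<in>UNIV. f g * cnj (\<psi> g)) = (\<Sum>g\<in>UNIV. f (g + h) * cnj (\<psi> (g + h)))"
    by (rule sum.reindex_bij_witness[of _ "\<lambda>g. g + h" "\<lambda>g. g - h"]) simp_all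
  also have "\<dots> = cnj (\<psi> h) * (\<Sum>g\<in>UNIV. f g * cnj (\<psi> g))"
    by (simp add: inv[OF h(1)] mult sum_distrib_left mult_ac)
  finally have "(1 - cnj (\<psi> h)) * (\<Sum>g\<in>UNIV. f g * cnj (\<psi> g)) = 0" by (simp add: algebra_simps)
  moreover have "1 - cnj (\<psi> h) \<noteq> 0" using h(2) by (metis complex_cnj_cnj complex_cnj_one right_minus_eq)
  ultimately show ?thesis by (simp add: fourier_def)
qed

lemma kernel_of_form:
  fixes d h w :: "'a::field \<times> 'a"
  assumes "d \<noteq> 0" "h \<noteq> 0" "form d h = 0" "form d w = 0"
  obtains c where "w = (c * fst h, c * snd h)"
proof (cases "w = 0")
  case True
  then show ?thesis by (intro that[of 0]) (simp add: prod_eq_iff)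
next
  case False
  have "form w d = 0" "form h d = 0" using assms(3,4) by (simp_all add: form_def mult.commute)
  then have "det2 w h = 0" using assms(1) by (rule form_det_zero)
  then obtain c where c: "\<And>g. form w g = c * form h g" using parallel_forms False assms(2) by metis
  from c[of "(1, 0)"] c[of "(0, 1)"] show ?thesis by (intro that[of c]) (simp add: form_def prod_eq_iff)
qed

lemma add_subgroup_scale:
  assumes H: "add_subgroup H" and "h \<in> H"
  shows "(c * fst h, c * snd h :: 'p::prime_card mod_ring) \<in> H"
proof -
  obtain k where k: "c = of_nat k" by (rule mod_ring_of_nat_cases)
  have "(of_nat k * fst h, of_nat k * snd h) \<in> H"
  proof (induction k)
    case 0
    then show ?case using H by (simp add: add_subgroup_def zero_prod_def)
  next
    case (Suc k)
    then have "h + (of_nat k * fst h, of_nat k * snd h) \<in> H"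
      using H \<open>h \<in> H\<close> unfolding add_subgroup_def by blast
    then show ?case by (cases h) (simp add: algebra_simps)
  qed
  then show ?thesis by (simp only: k)
qed

text \<open>A nontrivial character \<open>\<psi>\<close> that is trivial on \<open>H\<close> and outside the Fourier support would make its direction
  null; but \<open>f\<close> is constant on the fibres, which are \<open>H\<close>-cosets, so \<open>f\<close> would be constant.\<close>
lemma fourier_supp_exceptional:
  fixes f :: "'p::prime_card mod_ring \<times> 'p mod_ring \<Rightarrow> complex"
  assumes rat: "\<And>g. f g \<in> \<rat>"
    and H: "exceptional_subgroup f H"
    and nonconst: "\<not> f constant_on UNIV"
  shows "fourier_supp_from_subgroup f H"
proof -
  have sub: "add_subgroup H" using H by (simp add: exceptional_subgroup_def)
  then have "0 \<in> H" by (simp add: add_subgroup_def)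
  have inv: "f (g + h) = f g" if "h \<in> H" for g h
  proof -
    have "g + h \<in> g +o H" "g + 0 \<in> g +o H"
      using that \<open>0 \<in> H\<close> unfolding elt_set_plus_def by blast+
    moreover have "f constant_on (g +o H)" using H unfolding exceptional_subgroup_def by blast
    ultimately show ?thesis unfolding constant_on_def by (metis add_0_right)
  qed
  obtain h where h: "h \<in> H" "h \<noteq> 0"
    using H \<open>0 \<in> H\<close> unfolding exceptional_subgroup_def by blast
  obtain q \<phi> where "q \<noteq> 0" and q: "\<And>g. of_int q * f g = of_int (\<phi> g)"
    using common_denominator[of f] rat by metis
  have nonzero: "fourier f \<psi> \<noteq> 0" if \<psi>: "\<psi> \<in> perp H" "\<psi> \<noteq> principal_character" for \<psi>
  proof
    assume "fourier f \<psi> = 0"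
    have "\<psi> \<in> characters" using \<psi>(1) by (simp add: perp_def)
    then obtain d where d: "\<psi> = plane_char d" unfolding characters_eq_range_plane_char by blast
    have "d \<noteq> 0"
      using \<psi>(2) unfolding d principal_character_def by (auto simp: plane_char_def form_def)
    have "\<psi> h = 1" using \<psi>(1) h(1) by (auto simp: perp_def char_kernel_def)
    then have dh: "form d h = 0" by (simp add: d plane_char_def add_char_eq_1_iff)
    have fibre: "f g' = f g" if "form d g' = form d g" for g g'
    proof -
      have "form d (g' - g) = 0" using that by (simp add: form_diff)
      then obtain c where "g' - g = (c * fst h, c * snd h)"
        using kernel_of_form[OF \<open>d \<noteq> 0\<close> h(2) dh] by metis
      then have "g' - g \<in> H" using add_subgroup_scale[OF sub h(1)] by simp
      from inv[OF this, of g] show ?thesis by simp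
    qed
    have "null_direction \<phi> d"
      using null_direction_of_fourier_zero[of q f \<phi>, OF q] \<open>fourier f \<psi> = 0\<close> unfolding d by blast
    moreover have "fibre_sum \<phi> d (form d g) = int CARD('p) * \<phi> g" for g
    proof -
      have "\<phi> g' = \<phi> g" if "form d g' = form d g" for g'
      proof -
        have "of_int (\<phi> g') = (of_int (\<phi> g) :: complex)" unfolding q[symmetric] fibre[OF that] ..
        then show ?thesis by (rule of_int_eq_iff[THEN iffD1])
      qed
      then have "fibre_sum \<phi> d (form d g) = (\<Sum>g' | form d g' = form d g. \<phi> g)"
        unfolding fibre_sum_def by (intro sum.cong refl) blast
      then show ?thesis using card_fibre[OF \<open>d \<noteq> 0\<close>, of "form d g"] by simp
    qed
    ultimately have "int CARD('p) * \<phi> g = int CARD('p) * \<phi> 0" for g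
      unfolding null_direction_def by metis
    then have "of_int q * f g = of_int q * f 0" for g unfolding q by simp
    then have "f g = f 0" for g using \<open>q \<noteq> 0\<close> by simp
    then show False using nonconst unfolding constant_on_def by blast
  qed
  have supp: "fourier_supp f = {\<psi> \<in> perp H. fourier f \<psi> \<noteq> 0}"
    using fourier_zero_outside_perp[OF inv] unfolding fourier_supp_def support_on_def
    by (auto simp: perp_def)
  have principal: "principal_character \<in> perp H"
    by (simp add: perp_def char_kernel_def principal_character_def characters_def)
  have "fourier f principal_character = 0 \<longleftrightarrow> (\<Sum>g\<in>UNIV. f g) = 0"
    by (simp add: fourier_def principal_character_def)
  then show ?thesis
    unfolding fourier_supp_from_subgroup_def supp using nonzero principal by blast
qed

section \<open>The uncertainty inequality\<close>

text \<open>Here \<open>m\<close> stands for the number of non-null directions.\<close>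
lemma uncertainty_arith:
  fixes s x p :: real
  assumes p: "p > 1" and s: "s \<ge> 2 * (p + 1 - m)" and x: "x \<ge> (p - 1) * m" and m: "m \<ge> 2"
  shows "1 / 2 * min s x + 1 / (p - 1) * max s x \<ge> p + 1"
proof (cases "s \<le> x")
  case True
  have "1 / (p - 1) * x \<ge> m" using x p by (simp add: field_simps)
  with True s show ?thesis by simp
next
  case False
  have "1 / (p - 1) * s \<ge> m" using x False p by (simp add: field_simps)
  moreover have "(p + 1) * 2 \<le> (p + 1) * m" using p m by (intro mult_left_mono) simp_all
  ultimately show ?thesis using False x by (simp add: algebra_simps)
qed

lemma constant_on_iff: "f constant_on UNIV \<longleftrightarrow> (\<forall>g h. f g = f h)"
  by (auto simp: constant_on_def)

lemma exceptional_subgroup_kernel: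
  fixes f :: "'p::prime_card mod_ring \<times> 'p mod_ring \<Rightarrow> complex"
  assumes "d \<noteq> 0" and const: "\<And>g h. form d g = form d h \<Longrightarrow> f g = f h"
  shows "exceptional_subgroup f {g. form d g = 0}"
  unfolding exceptional_subgroup_def
proof (intro conjI allI)
  let ?H = "{g. form d g = 0}"
  have p: "CARD('p) \<ge> 2" by (rule prime_ge_2_nat[OF prime_card])
  have card: "card ?H = CARD('p)" using card_fibre[OF assms(1), of 0] by simp
  have "form d (- g) = - form d g" for g using form_diff[of d 0 g] by simp
  then show "add_subgroup ?H" by (simp add: add_subgroup_def form_add)
  show "?H \<noteq> {0}"
  proof
    assume "?H = {0}"
    then have "card ?H = card {0 :: 'p mod_ring \<times> 'p mod_ring}" by (rule arg_cong[of _ _ card])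
    then show False using card p by simp
  qed
  show "?H \<noteq> UNIV"
  proof
    assume "?H = UNIV"
    then have "card ?H = CARD('p mod_ring \<times> 'p mod_ring)" by (rule arg_cong[of _ _ card])
    then show False using card p by simp
  qed
  fix g
  have "f x = f g" if "x \<in> g +o ?H" for x
    using that by (intro const) (auto simp: elt_set_plus_def form_add)
  then show "f constant_on (g +o ?H)" unfolding constant_on_def by blast
qed

lemma uncertainty_or_exceptional:
  fixes f :: "'p::prime_card mod_ring \<times> 'p mod_ring \<Rightarrow> complex"
  defines "p \<equiv> CARD('p)" and "S \<equiv> supp f" and "X \<equiv> fourier_supp f"
  assumes p: "p \<ge> 3" and rat: "\<And>g. f g \<in> \<rat>" and nonzero: "\<exists>g. f g \<noteq> 0"
  shows "1 / 2 * min (real (card S)) (real (card X))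
             + 1 / (real p - 1) * max (real (card S)) (real (card X)) \<ge> real p + 1
          \<or> (\<exists>H. exceptional_subgroup f H \<and> fourier_supp_from_subgroup f H)"
    (is "?ineq \<or> _")
proof -
  obtain q \<phi> where "q \<noteq> 0" and q: "\<And>g. of_int q * f g = of_int (\<phi> g)"
    using common_denominator[of f] rat by metis
  have zero_iff: "f g = 0 \<longleftrightarrow> \<phi> g = 0" for g
    using q[of g] \<open>q \<noteq> 0\<close> by (metis mult_eq_0_iff of_int_eq_0_iff)
  have f_eq: "f g = f h" if "\<phi> g = \<phi> h" for g h
    using q[of g] q[of h] that \<open>q \<noteq> 0\<close> by (metis mult_left_cancel of_int_eq_0_iff)
  have S: "S = {g. \<phi> g \<noteq> 0}" by (simp add: S_def supp_def support_on_def zero_iff)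
  obtain g0 where g0: "\<phi> g0 \<noteq> 0" using nonzero zero_iff by blast
  \<comment> \<open>The null and the non-null directions.\<close>
  define N where "N = {d \<in> directions. null_direction \<phi> d}"
  define M where "M = {d \<in> directions. \<not> null_direction \<phi> d}"
  have MN: "card N + card M = p + 1"
  proof -
    have "card (N \<union> M) = card N + card M"
      by (rule card_Un_disjoint) (auto simp: N_def M_def)
    moreover have "N \<union> M = directions" by (auto simp: N_def M_def)
    ultimately show ?thesis using card_directions[where 'a = "'p mod_ring"] p_def by simp
  qed
  have X: "(p - 1) * card M \<le> card X"
    using card_fourier_supp_ge[of q f \<phi>, OF q] unfolding p_def X_def M_def .
  show ?thesis
  proof (cases "card M \<ge> 2")
    case True
    have "2 * card N \<le> card S"
      unfolding S N_def by (rule card_supp_ge[of \<phi> g0, OF _ g0]) (use MN True p_def N_def in simp)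
    then have "real (2 * card N) \<le> real (card S)" by (rule of_nat_mono)
    moreover have "real (card N) + real (card M) = real p + 1"
      using arg_cong[OF MN, of real] by simp
    ultimately have "real (card S) \<ge> 2 * (real p + 1 - real (card M))" by simp
    moreover have "real ((p - 1) * card M) \<le> real (card X)" using X by (rule of_nat_mono)
    then have "real (card X) \<ge> (real p - 1) * real (card M)"
      using p by (simp add: of_nat_diff)
    ultimately have ?ineq
      using True p by (intro uncertainty_arith[where m = "real (card M)"]) simp_all
    then show ?thesis ..
  next
    case False
    then have M1: "card M \<le> Suc 0" by simp
    have "(0, 1) \<in> (directions :: ('p mod_ring \<times> 'p mod_ring) set)" by (simp add: directions_def)
    moreover have "d = d'" if "d \<in> M" "d' \<in> M" for d d'
      using card_le_Suc0_iff_eq[OF finite, of M, THEN iffD1, OF M1] that by blast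
    ultimately obtain d0 where d0: "d0 \<in> directions" "\<And>d. d \<in> directions \<Longrightarrow> d \<noteq> d0 \<Longrightarrow> null_direction \<phi> d"
      unfolding M_def by (metis (mono_tags, lifting) mem_Collect_eq)
    have const: "f g = f h" if "form d0 g = form d0 h" for g h
      by (rule f_eq, rule constant_on_fibres[OF d0 that])
    have exc: "exceptional_subgroup f {g. form d0 g = 0}"
      using directions_nonzero[OF d0(1)] const by (rule exceptional_subgroup_kernel)
    show ?thesis
    proof (cases "f constant_on UNIV")
      case False
      then show ?thesis using exc fourier_supp_exceptional[of f, OF rat exc] by blast
    next
      \<comment> \<open>For a constant function the whole plane is the support, and \<open>p^2 / (p - 1) > p + 1\<close>.\<close>
      case True
      then have "f g \<noteq> 0" for g using nonzero unfolding constant_on_iff by metis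
      then have "S = UNIV" by (simp add: S_def supp_def support_on_def)
      then have "real (card S) = real p * real p" by (simp add: p_def)
      then have "real p * real p \<le> max (real (card S)) (real (card X))" by simp
      then have "1 / (real p - 1) * (real p * real p)
          \<le> 1 / (real p - 1) * max (real (card S)) (real (card X))"
        using p by (intro mult_left_mono) simp_all
      moreover have "real p + 1 \<le> 1 / (real p - 1) * (real p * real p)"
        using p by (simp add: field_simps)
      moreover have "0 \<le> 1 / 2 * min (real (card S)) (real (card X))" by simp
      ultimately have ?ineq by linarith
      then show ?thesis ..
    qed
  qed
qed

theorem theorem1:
  fixes f :: "'p::prime_card mod_ring \<times> 'p mod_ring \<Rightarrow> complex"
    and p :: nat
    and S :: "('p mod_ring \<times> 'p mod_ring) set"
    and X :: "('p mod_ring \<times> 'p mod_ring \<Rightarrow> complex) set"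
  assumes "p = CARD('p)" and "p \<ge> 3"
    and "\<And>g. f g \<in> \<rat>"
    and "\<exists>g. f g \<noteq> 0"
    and "S = supp f" and "X = fourier_supp f"
  shows "(1 / 2 * min (real (card S)) (real (card X))
             + 1 / (real p - 1) * max (real (card S)) (real (card X)) \<ge> real p + 1
          \<or> (\<exists>H. exceptional_subgroup f H \<and> fourier_supp_from_subgroup f H))
         \<and> (\<forall>H. exceptional_subgroup f H \<and> \<not> f constant_on UNIV \<longrightarrow>
               fourier_supp_from_subgroup f H)"
proof (intro conjI allI impI)
  show "fourier_supp_from_subgroup f H" if "exceptional_subgroup f H \<and> \<not> f constant_on UNIV" for H
    using fourier_supp_exceptional[of f, OF assms(3)] that by blast
qed (use uncertainty_or_exceptional[of f] assms in simp)

end
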